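(* Let $\mathcal{O}$ be a non-symmetric operad with a multiplication $\pi\in\mathcal{O}(2)$, and let $\mathfrak{g}$ be the differential graded Lie algebra $(\mathcal{O}(\bullet+1),[\,,\,],d_\pi)$. Then the set of equivalence classes of formal deformations of $\pi$ is given by the moduli space $\mathfrak{Def}(\mathfrak{g})=\mathrm{MC}(\mathfrak{g})/G(\mathfrak{g})$ of solutions of the Maurer-Cartan equation: the assignment $\gamma\mapsto\pi+\gamma$ induces a bijection from $\mathfrak{Def}(\mathfrak{g})$ onto the set of equivalence classes of formal deformations of $\pi$.
   Context: All vector spaces are over a field $\mathbb{K}$ of characteristic $0$. A non-symmetric operad is a collection $\mathcal{O}=\{\mathcal{O}(n)\}_{n\ge 1}$ of vector spaces with bilinear partial compositions $\circ_i:\mathcal{O}(m)\otimes\mathcal{O}(n)\to\mathcal{O}(m+n-1)$, $1\le i\le m$, such that for $f\in\mathcal{O}(m), g\in\mathcal{O}(n), h\in\mathcal{O}(p)$: $(f\circ_i g)\circ_{i+j-1}h=f\circ_i(g\circ_j h)$ for $1\le i\le m,\ 1\le j\le n$; $(f\circ_i g)\circ_{j+n-1}h=(f\circ_j h)\circ_i g$ for $1\le i<j\le m$; and an element $\mathrm{id}\in\mathcal{O}(1)$ with $f\circ_i\mathrm{id}=f=\mathrm{id}\circ_1 f$. For $f\in\mathcal{O}(n)$ put $|f|=n-1$. For $f\in\mathcal{O}(2)$ and $g,h\in\mathcal{O}(1)$ write $\gamma(f;g,h)=(f\circ_2 h)\circ_1 g$. The circle product is $f\circ g=\sum_{i=1}^m(-1)^{(i-1)|g|}f\circ_i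 g$ for $f\in\mathcal{O}(m)$, and $[f,g]=f\circ g-(-1)^{|f||g|}g\circ f$. A multiplication on $\mathcal{O}$ is an element $\pi\in\mathcal{O}(2)$ with $\pi\circ\pi=0$; it defines $d_\pi:\mathcal{O}(n)\to\mathcal{O}(n+1)$, $d_\pi f=\pi\circ f-(-1)^{|f|}f\circ\pi=[\pi,f]$. With $\mathfrak{g}^n=\mathcal{O}(n+1)$, the triple $\mathfrak{g}=(\mathcal{O}(\bullet+1),[\,,\,],d_\pi)$ is a differential graded Lie algebra (dgLa). All operations are extended $\mathbb{K}[[t]]$-linearly to formal power series. A formal deformation of $\pi$ is $\pi_t=\sum_{i\ge0}\pi_it^i\in\mathcal{O}(2)[[t]]$ with $\pi_0=\pi$ and $\pi_t\circ\pi_t=0$. Two deformations $\pi_t,\pi_t'$ are equivalent if there is $\phi_t=\sum_{i\ge0}\phi_it^i\in\mathcal{O}(1)[[t]]$ with $\phi_0=\mathrm{id}$ and $\phi_t\circ\pi_t'=\gamma(\pi_t;\phi_t,\phi_t)$. For a dgLa $\mathfrak{g}$ let $L=\mathfrak{g}\otimes(t)$, where $(t)\subset\mathbb{K}[[t]]$ is the ideal generated by $t$; degree $n$ elements of $L$ are the power series $f_1t+f_2t^2+\cdots$ with $f_i\in\mathfrak{g}^n$, and $L$ has the induced dgLa structure. $\mathrm{MC}(\mathfrak{g})$ is the set of $\gamma\in L^1$ with $d\gamma+\frac12[\gamma,\gamma]=0$. The gauge group $G(\mathfrak{g})=\exp(L^0)$ has underlying set $L^0$ and multiplication given by the Baker-Campbell-Hausdorff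 formula. It acts on $L^1$ by the gauge action $x\cdot\gamma=e^{\mathrm{ad}_x}\gamma-\frac{e^{\mathrm{ad}_x}-1}{\mathrm{ad}_x}(dx)$, where $\mathrm{ad}_x=[x,-]$; for $\mathfrak{g}=(\mathcal{O}(\bullet+1),[\,,\,],d_\pi)$ this means $\pi+x\cdot\gamma=e^{\mathrm{ad}_x}(\pi+\gamma)$. This action preserves $\mathrm{MC}(\mathfrak{g})$, and $\mathfrak{Def}(\mathfrak{g})=\mathrm{MC}(\mathfrak{g})/G(\mathfrak{g})$ is the orbit set. *)

theory Defs
  imports
    "HOL-Computational_Algebra.Formal_Power_Series"
    "HOL-Algebra.Group_Action"
begin

section \<open>Non-symmetric operads\<close>

text \<open>
  A family of vector spaces \<open>\<O>(n)\<close>, \<open>n \<ge> 1\<close>, is given by subspaces of one ambient vector space (any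
  family is of this form, inside its direct sum). The subspaces are not required to be independent,
  so all operations carry the arities of their arguments: \<open>pcomp \<O> m n i f g\<close> is
  \<open>f \<circ>\<^sub>i g\<close> for \<open>f \<in> \<O>(m)\<close>, \<open>g \<in> \<O>(n)\<close>. Nothing is assumed about arity \<open>0\<close>.
\<close>

record ('k, 'a) operad =
  opscale :: "'k \<Rightarrow> 'a \<Rightarrow> 'a"
  opspace :: "nat \<Rightarrow> 'a set"
  pcomp :: "nat \<Rightarrow> nat \<Rightarrow> nat \<Rightarrow> 'a \<Rightarrow> 'a \<Rightarrow> 'a"
  opid :: 'a

locale ns_operad =
  fixes \<O> :: "('k::field_char_0, 'a::ab_group_add) operad"
  assumes vector_space: "vector_space (opscale \<O>)"
    and subspace: "1 \<le> n \<Longrightarrow> module.subspace (opscale \<O>) (opspace \<O> n)"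
    and pcomp_closed:
      "\<lbrakk>1 \<le> i; i \<le> m; 1 \<le> n; f \<in> opspace \<O> m; g \<in> opspace \<O> n\<rbrakk>
        \<Longrightarrow> pcomp \<O> m n i f g \<in> opspace \<O> (m + n - 1)"
    and pcomp_add_left:
      "\<lbrakk>1 \<le> i; i \<le> m; 1 \<le> n; f \<in> opspace \<O> m; f' \<in> opspace \<O> m; g \<in> opspace \<O> n\<rbrakk>
        \<Longrightarrow> pcomp \<O> m n i (f + f') g = pcomp \<O> m n i f g + pcomp \<O> m n i f' g"
    and pcomp_add_right:
      "\<lbrakk>1 \<le> i; i \<le> m; 1 \<le> n; f \<in> opspace \<O> m; g \<in> opspace \<O> n; g' \<in> opspace \<O> n\<rbrakk>
        \<Longrightarrow> pcomp \<O> m n i f (g + g') = pcomp \<O> m n i f g + pcomp \<O> m n i f g'"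
    and pcomp_scale_left:
      "\<lbrakk>1 \<le> i; i \<le> m; 1 \<le> n; f \<in> opspace \<O> m; g \<in> opspace \<O> n\<rbrakk>
        \<Longrightarrow> pcomp \<O> m n i (opscale \<O> c f) g = opscale \<O> c (pcomp \<O> m n i f g)"
    and pcomp_scale_right:
      "\<lbrakk>1 \<le> i; i \<le> m; 1 \<le> n; f \<in> opspace \<O> m; g \<in> opspace \<O> n\<rbrakk>
        \<Longrightarrow> pcomp \<O> m n i f (opscale \<O> c g) = opscale \<O> c (pcomp \<O> m n i f g)"
    and pcomp_sequential:
      "\<lbrakk>1 \<le> i; i \<le> m; 1 \<le> j; j \<le> n; 1 \<le> p;
        f \<in> opspace \<O> m; g \<in> opspace \<O> n; h \<in> opspace \<O> p\<rbrakk>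
        \<Longrightarrow> pcomp \<O> (m + n - 1) p (i + j - 1) (pcomp \<O> m n i f g) h
          = pcomp \<O> m (n + p - 1) i f (pcomp \<O> n p j g h)"
    and pcomp_parallel:
      "\<lbrakk>1 \<le> i; i < j; j \<le> m; 1 \<le> n; 1 \<le> p;
        f \<in> opspace \<O> m; g \<in> opspace \<O> n; h \<in> opspace \<O> p\<rbrakk>
        \<Longrightarrow> pcomp \<O> (m + n - 1) p (j + n - 1) (pcomp \<O> m n i f g) h
          = pcomp \<O> (m + p - 1) n i (pcomp \<O> m p j f h) g"
    and opid_closed: "opid \<O> \<in> opspace \<O> 1"
    and pcomp_opid_right:
      "\<lbrakk>1 \<le> i; i \<le> m; f \<in> opspace \<O> m\<rbrakk> \<Longrightarrow> pcomp \<O> m 1 i f (opid \<O>) = f"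
    and pcomp_opid_left:
      "\<lbrakk>1 \<le> m; f \<in> opspace \<O> m\<rbrakk> \<Longrightarrow> pcomp \<O> 1 m 1 (opid \<O>) f = f"

text \<open>\<open>\<gamma>(f; g, h)\<close> for \<open>f\<close> of arity 2 and \<open>g\<close>, \<open>h\<close> of arity 1.\<close>

definition operad_gamma :: "('k, 'a) operad \<Rightarrow> 'a \<Rightarrow> 'a \<Rightarrow> 'a \<Rightarrow> 'a" where
  "operad_gamma \<O> f g h = pcomp \<O> 2 1 1 (pcomp \<O> 2 1 2 f h) g"

text \<open>The degree of an element of arity \<open>n\<close> is \<open>n - 1\<close>.\<close>

definition circ ::
    "('k::field_char_0, 'a::ab_group_add) operad \<Rightarrow> nat \<Rightarrow> nat \<Rightarrow> 'a \<Rightarrow> 'a \<Rightarrow> 'a" where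
  "circ \<O> m n f g = (\<Sum>i=1..m. opscale \<O> ((-1) ^ ((i - 1) * (n - 1))) (pcomp \<O> m n i f g))"

definition operad_bracket ::
    "('k::field_char_0, 'a::ab_group_add) operad \<Rightarrow> nat \<Rightarrow> nat \<Rightarrow> 'a \<Rightarrow> 'a \<Rightarrow> 'a" where
  "operad_bracket \<O> m n f g =
     circ \<O> m n f g - opscale \<O> ((-1) ^ ((m - 1) * (n - 1))) (circ \<O> n m g f)"

definition operad_diff ::
    "('k::field_char_0, 'a::ab_group_add) operad \<Rightarrow> 'a \<Rightarrow> nat \<Rightarrow> 'a \<Rightarrow> 'a" where
  "operad_diff \<O> \<pi> n f = circ \<O> 2 n \<pi> f - opscale \<O> ((-1) ^ (n - 1)) (circ \<O> n 2 f \<pi>)"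

definition multiplication ::
    "('k::field_char_0, 'a::ab_group_add) operad \<Rightarrow> 'a \<Rightarrow> bool" where
  "multiplication \<O> \<pi> \<longleftrightarrow> \<pi> \<in> opspace \<O> 2 \<and> circ \<O> 2 2 \<pi> \<pi> = 0"


section \<open>Extension of operations to formal power series\<close>

definition fps_linear_ext :: "('a \<Rightarrow> 'b) \<Rightarrow> 'a fps \<Rightarrow> 'b fps" where
  "fps_linear_ext u F = Abs_fps (\<lambda>k. u (fps_nth F k))"

definition fps_bilinear_ext ::
    "('a \<Rightarrow> 'b \<Rightarrow> 'c::comm_monoid_add) \<Rightarrow> 'a fps \<Rightarrow> 'b fps \<Rightarrow> 'c fps" where
  "fps_bilinear_ext b F G = Abs_fps (\<lambda>k. \<Sum>i=0..k. b (fps_nth F i) (fps_nth G (k - i)))"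

text \<open>The operad \<open>\<O>[[t]]\<close>, regarded over the base field.\<close>

definition operad_fps ::
    "('k::field_char_0, 'a::ab_group_add) operad \<Rightarrow> ('k, 'a fps) operad" where
  "operad_fps \<O> =
     \<lparr> opscale = (\<lambda>c. fps_linear_ext (opscale \<O> c)),
       opspace = (\<lambda>n. {F. \<forall>k. fps_nth F k \<in> opspace \<O> n}),
       pcomp = (\<lambda>m n i. fps_bilinear_ext (pcomp \<O> m n i)),
       opid = fps_const (opid \<O>) \<rparr>"


section \<open>Formal deformations of a multiplication\<close>

definition deformations ::
    "('k::field_char_0, 'a::ab_group_add) operad \<Rightarrow> 'a \<Rightarrow> 'a fps set" where
  "deformations \<O> \<pi> =
     {P \<in> opspace (operad_fps \<O>) 2. fps_nth P 0 = \<pi> \<and> circ (operad_fps \<O>) 2 2 P P = 0}"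

definition deformation_equiv ::
    "('k::field_char_0, 'a::ab_group_add) operad \<Rightarrow> 'a \<Rightarrow> ('a fps \<times> 'a fps) set" where
  "deformation_equiv \<O> \<pi> =
     {(P, P'). P \<in> deformations \<O> \<pi> \<and> P' \<in> deformations \<O> \<pi> \<and>
        (\<exists>\<phi> \<in> opspace (operad_fps \<O>) 1. fps_nth \<phi> 0 = opid \<O> \<and>
           circ (operad_fps \<O>) 1 2 \<phi> P' = operad_gamma (operad_fps \<O>) P \<phi> \<phi>)}"


section \<open>Differential graded Lie algebras and their moduli spaces\<close>

text \<open>
  The data (not the axioms) of a non-negatively graded dgLa: \<open>dgspace \<gg> n\<close> is \<open>\<gg>\<^sup>n\<close>, and
  bracket and differential carry the degrees of their arguments.
\<close>

record ('k, 'a) dgla =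
  dgscale :: "'k \<Rightarrow> 'a \<Rightarrow> 'a"
  dgspace :: "nat \<Rightarrow> 'a set"
  dgbracket :: "nat \<Rightarrow> nat \<Rightarrow> 'a \<Rightarrow> 'a \<Rightarrow> 'a"
  dgdiff :: "nat \<Rightarrow> 'a \<Rightarrow> 'a"

definition operad_dgla ::
    "('k::field_char_0, 'a::ab_group_add) operad \<Rightarrow> 'a \<Rightarrow> ('k, 'a) dgla" where
  "operad_dgla \<O> \<pi> =
     \<lparr> dgscale = opscale \<O>,
       dgspace = (\<lambda>n. opspace \<O> (n + 1)),
       dgbracket = (\<lambda>p q. operad_bracket \<O> (p + 1) (q + 1)),
       dgdiff = (\<lambda>n. operad_diff \<O> \<pi> (n + 1)) \<rparr>"

text \<open>The dgLa \<open>L = \<gg> \<otimes> (t)\<close>.\<close>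

definition dgla_t :: "('k, 'a::ab_group_add) dgla \<Rightarrow> ('k, 'a fps) dgla" where
  "dgla_t \<gg> =
     \<lparr> dgscale = (\<lambda>c. fps_linear_ext (dgscale \<gg> c)),
       dgspace = (\<lambda>n. {F. fps_nth F 0 = 0 \<and> (\<forall>k. fps_nth F k \<in> dgspace \<gg> n)}),
       dgbracket = (\<lambda>p q. fps_bilinear_ext (dgbracket \<gg> p q)),
       dgdiff = (\<lambda>n. fps_linear_ext (dgdiff \<gg> n)) \<rparr>"

definition maurer_cartan :: "('k::field_char_0, 'a::ab_group_add) dgla \<Rightarrow> 'a fps set" where
  "maurer_cartan \<gg> = (let L = dgla_t \<gg> in
     {\<gamma> \<in> dgspace L 1. dgdiff L 1 \<gamma> + dgscale L (1 / 2) (dgbracket L 1 1 \<gamma> \<gamma>) = 0})"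

text \<open>
  Infinite sums of power series (\<open>suminf\<close>) are taken in the \<open>t\<close>-adic metric of the type \<open>fps\<close>. They
  converge below, as every element of \<open>L\<close> is divisible by \<open>t\<close>.

  The Baker--Campbell--Hausdorff product is given by Dynkin's formula
  \[ \sum_{n \ge 1} \frac{(-1)^{n-1}}{n} \sum_{r_i + s_i > 0}
     \frac{[x^{r_1} y^{s_1} \cdots x^{r_n} y^{s_n}]}{\sum_i (r_i + s_i) \prod_i r_i! s_i!} \]
  with brackets nested to the right, grouped by the length \<open>N\<close> of the words.
\<close>

fun nested_bracket :: "('a \<Rightarrow> 'a \<Rightarrow> 'a) \<Rightarrow> 'a::zero list \<Rightarrow> 'a" where
  "nested_bracket b [] = 0"
| "nested_bracket b [z] = z"
| "nested_bracket b (z # w # ws) = b z (nested_bracket b (w # ws))"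

definition dynkin_exponents :: "nat \<Rightarrow> nat \<Rightarrow> (nat \<times> nat) list set" where
  "dynkin_exponents n N =
     {rs. length rs = n \<and> (\<forall>(r, s) \<in> set rs. r + s > 0) \<and> (\<Sum>(r, s) \<leftarrow> rs. r + s) = N}"

definition dynkin_term ::
    "('k::field_char_0 \<Rightarrow> 'a \<Rightarrow> 'a) \<Rightarrow> ('a \<Rightarrow> 'a \<Rightarrow> 'a) \<Rightarrow> nat \<Rightarrow> 'a \<Rightarrow> 'a \<Rightarrow> 'a::ab_group_add" where
  "dynkin_term scl b N x y =
     (\<Sum>n=1..N. \<Sum>rs \<in> dynkin_exponents n N.
        scl ((-1) ^ (n - 1) / (of_nat n * of_nat N * (\<Prod>(r, s) \<leftarrow> rs. fact r * fact s)))
          (nested_bracket b (concat (map (\<lambda>(r, s). replicate r x @ replicate s y) rs))))"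

definition bch ::
    "('k::field_char_0, 'a::ab_group_add) dgla \<Rightarrow> 'a fps \<Rightarrow> 'a fps \<Rightarrow> 'a fps" where
  "bch \<gg> x y = (let L = dgla_t \<gg> in
     (\<Sum>N. dynkin_term (dgscale L) (dgbracket L 0 0) (Suc N) x y))"

definition gauge_group :: "('k::field_char_0, 'a::ab_group_add) dgla \<Rightarrow> 'a fps monoid" where
  "gauge_group \<gg> = \<lparr> carrier = dgspace (dgla_t \<gg>) 0, mult = bch \<gg>, one = 0 \<rparr>"

text \<open>The gauge action \<open>x \<cdot> \<gamma> = e\<^bsup>ad x\<^esup> \<gamma> - ((e\<^bsup>ad x\<^esup> - 1) / ad x) (d x)\<close>\<close>

definition gauge_action ::
    "('k::field_char_0, 'a::ab_group_add) dgla \<Rightarrow> 'a fps \<Rightarrow> 'a fps \<Rightarrow> 'a fps" where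
  "gauge_action \<gg> x \<gamma> = (let L = dgla_t \<gg>; ad = dgbracket L 0 1 x in
     (\<Sum>n. dgscale L (1 / fact n) ((ad ^^ n) \<gamma>)) -
     (\<Sum>n. dgscale L (1 / fact (Suc n)) ((ad ^^ n) (dgdiff L 0 x))))"

definition moduli_space :: "('k::field_char_0, 'a::ab_group_add) dgla \<Rightarrow> 'a fps set set" where
  "moduli_space \<gg> = orbits (gauge_group \<gg>) (maurer_cartan \<gg>) (gauge_action \<gg>)"

end

theory Submission
  imports Defs
begin

text \<open>
  On \<open>\<O>(2)[[t]]\<close> the operator \<open>ad\<^sub>x\<close>, for \<open>x\<close> of degree \<open>0\<close>, is the sum of three commuting
  operators: \<open>P \<mapsto> x \<circ>\<^sub>1 P\<close>, \<open>P \<mapsto> - P \<circ>\<^sub>1 x\<close> and \<open>P \<mapsto> - P \<circ>\<^sub>2 x\<close>. Hence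
  \<open>e\<^bsup>ad x\<^esup> P = e\<^sup>x \<circ> \<gamma>(P; \<phi>, \<phi>)\<close> with \<open>\<phi> = e\<^bsup>-x\<^esup>\<close>, where the exponential is taken in the
  associative algebra \<open>\<O>(1)[[t]]\<close>, and for a Maurer--Cartan element \<open>\<mu>\<close> the equation
  \<open>\<pi> + x \<cdot> \<mu> = P'\<close> means exactly that \<open>\<phi> \<circ> P' = \<gamma>(\<pi> + \<mu>; \<phi>, \<phi>)\<close>. Since every \<open>\<phi>\<close> with constant
  term \<open>id\<close> is such an exponential, translation by \<open>\<pi>\<close> maps gauge orbits onto equivalence classes
  of deformations. Orbits as sets do not involve the group law, so no property of the
  Baker--Campbell--Hausdorff product enters.
\<close>

unbundle fps_syntax

declare One_nat_def [simp del]

section \<open>Low arities and power series over an operad\<close>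

context ns_operad
begin

sublocale vector_space "opscale \<O>"
  by (rule vector_space)

lemmas space_0 = subspace_0[OF subspace]
  and space_add = subspace_add[OF subspace]
  and space_diff = subspace_diff[OF subspace]
  and space_neg = subspace_neg[OF subspace]
  and space_scale = subspace_scale[OF subspace]
  and space_sum = subspace_sum[OF subspace]

lemma pcomp_zero_left [simp]:
  assumes "1 \<le> i" "i \<le> m" "1 \<le> n" "g \<in> opspace \<O> n"
  shows "pcomp \<O> m n i 0 g = 0"
  using pcomp_scale_left[of i m n 0 g 0] assms space_0[of m] by simp

lemma pcomp_zero_right [simp]:
  assumes "1 \<le> i" "i \<le> m" "1 \<le> n" "f \<in> opspace \<O> m"
  shows "pcomp \<O> m n i f 0 = 0"
  using pcomp_scale_right[of i m n f 0 0] assms space_0[of n] by simp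

lemma pcomp_minus_left:
  assumes "1 \<le> i" "i \<le> m" "1 \<le> n" "f \<in> opspace \<O> m" "g \<in> opspace \<O> n"
  shows "pcomp \<O> m n i (- f) g = - pcomp \<O> m n i f g"
  using pcomp_scale_left[OF assms, of "- 1"] by simp

lemma pcomp_minus_right:
  assumes "1 \<le> i" "i \<le> m" "1 \<le> n" "f \<in> opspace \<O> m" "g \<in> opspace \<O> n"
  shows "pcomp \<O> m n i f (- g) = - pcomp \<O> m n i f g"
  using pcomp_scale_right[OF assms, of "- 1"] by simp

lemma pcomp_sum_left:
  assumes "1 \<le> i" "i \<le> m" "1 \<le> n" "\<And>s. s \<in> S \<Longrightarrow> f s \<in> opspace \<O> m" "g \<in> opspace \<O> n"
  shows "pcomp \<O> m n i (\<Sum>s\<in>S. f s) g = (\<Sum>s\<in>S. pcomp \<O> m n i (f s) g)"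
  using assms(4)
proof (induction S rule: infinite_finite_induct)
  case (insert s S)
  then show ?case using assms by (simp add: pcomp_add_left space_sum)
qed (use assms in simp_all)

lemma pcomp_sum_right:
  assumes "1 \<le> i" "i \<le> m" "1 \<le> n" "f \<in> opspace \<O> m" "\<And>s. s \<in> S \<Longrightarrow> g s \<in> opspace \<O> n"
  shows "pcomp \<O> m n i f (\<Sum>s\<in>S. g s) = (\<Sum>s\<in>S. pcomp \<O> m n i f (g s))"
  using assms(5)
proof (induction S rule: infinite_finite_induct)
  case (insert s S)
  then show ?case using assms by (simp add: pcomp_add_right space_sum)
qed (use assms in simp_all)

lemma pcomp_unary_left:
  assumes "x \<in> opspace \<O> 1" "1 \<le> m" "f \<in> opspace \<O> m"
  shows "pcomp \<O> 1 m 1 x f \<in> opspace \<O> m"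
  using pcomp_closed[of 1 1 m x f] assms by simp

lemma pcomp_unary_right:
  assumes "x \<in> opspace \<O> 1" "1 \<le> i" "i \<le> m" "f \<in> opspace \<O> m"
  shows "pcomp \<O> m 1 i f x \<in> opspace \<O> m"
  using pcomp_closed[of i m 1 f x] assms by simp

text \<open>The sequential axiom with the unary element outermost: postcomposition with
  \<open>x\<close> commutes with every insertion.\<close>

lemma pcomp_unary_assoc_left:
  assumes "x \<in> opspace \<O> 1" "1 \<le> i" "i \<le> m" "1 \<le> n" "f \<in> opspace \<O> m" "g \<in> opspace \<O> n"
  shows "pcomp \<O> m n i (pcomp \<O> 1 m 1 x f) g = pcomp \<O> 1 (m + n - 1) 1 x (pcomp \<O> m n i f g)"
  using pcomp_sequential[of 1 1 i m n x f g] assms by simp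

text \<open>The sequential axiom with the unary element in the middle: \<open>x\<close> passes from
  an input of \<open>f\<close> to the output of whatever is inserted there. For
  \<open>m = n = 1\<close> this is associativity of \<O>(1).\<close>

lemma pcomp_unary_assoc_right:
  assumes "x \<in> opspace \<O> 1" "1 \<le> i" "i \<le> m" "1 \<le> n" "f \<in> opspace \<O> m" "g \<in> opspace \<O> n"
  shows "pcomp \<O> m n i (pcomp \<O> m 1 i f x) g = pcomp \<O> m n i f (pcomp \<O> 1 n 1 x g)"
  using pcomp_sequential[of i m 1 1 n f x g] assms by simp

lemma pcomp_unary_unary_commute:
  assumes "x \<in> opspace \<O> 1" "y \<in> opspace \<O> 1" "f \<in> opspace \<O> 2"
  shows "pcomp \<O> 2 1 2 (pcomp \<O> 2 1 1 f x) y = pcomp \<O> 2 1 1 (pcomp \<O> 2 1 2 f y) x"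
  using pcomp_parallel[of 1 2 2 1 1 f x y] assms by simp

lemma gamma_closed:
  assumes "f \<in> opspace \<O> 2" "x \<in> opspace \<O> 1" "y \<in> opspace \<O> 1"
  shows "operad_gamma \<O> f x y \<in> opspace \<O> 2"
  using assms by (simp add: operad_gamma_def pcomp_unary_right)

lemma gamma_opid: "f \<in> opspace \<O> 2 \<Longrightarrow> operad_gamma \<O> f (opid \<O>) (opid \<O>) = f"
  by (simp add: operad_gamma_def pcomp_opid_right)

text \<open>Insertions into different inputs commute, so the two unary elements meant for one input
  can be brought together there and merged by associativity, with \<open>x\<close>
  outermost.\<close>

lemma gamma_gamma:
  assumes "f \<in> opspace \<O> 2" "x \<in> opspace \<O> 1" "y \<in> opspace \<O> 1"
  shows "operad_gamma \<O> (operad_gamma \<O> f x x) y y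
    = operad_gamma \<O> f (pcomp \<O> 1 1 1 x y) (pcomp \<O> 1 1 1 x y)"
proof -
  have "operad_gamma \<O> (operad_gamma \<O> f x x) y y
      = pcomp \<O> 2 1 1 (pcomp \<O> 2 1 1 (pcomp \<O> 2 1 2 (pcomp \<O> 2 1 2 f x) y) x) y"
    using assms by (simp add: operad_gamma_def pcomp_unary_unary_commute pcomp_unary_right)
  then show ?thesis
    using assms by (simp add: operad_gamma_def pcomp_unary_assoc_right pcomp_unary_right)
qed

lemma pcomp_unary_gamma:
  assumes "f \<in> opspace \<O> 2" "x \<in> opspace \<O> 1" "y \<in> opspace \<O> 1" "z \<in> opspace \<O> 1"
  shows "operad_gamma \<O> (pcomp \<O> 1 2 1 z f) x y = pcomp \<O> 1 2 1 z (operad_gamma \<O> f x y)"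
  using assms pcomp_unary_assoc_left[of z _ 2 1]
  by (simp add: operad_gamma_def pcomp_unary_right)

lemma circ_1 [simp]: "circ \<O> 1 n f g = pcomp \<O> 1 n 1 f g"
  by (simp add: circ_def)

lemma circ_2: "circ \<O> 2 n f g
    = pcomp \<O> 2 n 1 f g + opscale \<O> ((- 1) ^ (n - 1)) (pcomp \<O> 2 n 2 f g)"
proof -
  have "{1..2::nat} = {1, 2}"
    by auto
  then show ?thesis
    by (simp add: circ_def)
qed

lemma circ_2_2: "circ \<O> 2 2 f f = pcomp \<O> 2 2 1 f f - pcomp \<O> 2 2 2 f f"
  by (simp add: circ_2)

text \<open>
  Here \<open>x\<close> is an isomorphism from \<open>f'\<close> to \<open>f\<close>, so \<open>x \<circ> (f' \<circ>\<^sub>i f')\<close> is \<open>f \<circ>\<^sub>i f\<close> with \<open>x\<close> inserted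
  into all three inputs, for both values of \<open>i\<close>.
\<close>

lemma circ_2_2_transfer:
  assumes f: "f \<in> opspace \<O> 2" and f': "f' \<in> opspace \<O> 2"
    and x: "x \<in> opspace \<O> 1" and y: "y \<in> opspace \<O> 1" and yx: "pcomp \<O> 1 1 1 y x = opid \<O>"
    and eq: "pcomp \<O> 1 2 1 x f' = operad_gamma \<O> f x x"
    and 0: "circ \<O> 2 2 f f = 0"
  shows "circ \<O> 2 2 f' f' = 0"
proof -
  \<comment> \<open>\<open>T\<close> puts \<open>x\<close> into all three inputs of a ternary
    element.\<close>
  define T where "T h = pcomp \<O> 3 1 1 (pcomp \<O> 3 1 2 (pcomp \<O> 3 1 3 h x) x) x" for h
  have c: "pcomp \<O> 2 1 i g x \<in> opspace \<O> 2" if "i \<in> {1,2}" "g \<in> opspace \<O> 2" for i g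
    using that x by (auto intro: pcomp_unary_right)
  have c3: "pcomp \<O> 2 2 i f f \<in> opspace \<O> 3" if "i \<in> {1,2}" for i
    using that f pcomp_closed[of i 2 2 f f] by auto
  have c3': "pcomp \<O> 2 2 i f' f' \<in> opspace \<O> 3" if "i \<in> {1,2}" for i
    using that f' pcomp_closed[of i 2 2 f' f'] by auto
  \<comment> \<open>\<open>s1\<close> and \<open>s2\<close> treat the inputs of the inserted element
    \<open>h\<close>; \<open>p1\<close> and \<open>p2\<close> treat the input of \<open>g\<close>
    that the insertion leaves free.\<close>
  have s1: "pcomp \<O> 3 1 j (pcomp \<O> 2 2 1 g h) x = pcomp \<O> 2 2 1 g (pcomp \<O> 2 1 j h x)"
    if "j \<in> {1,2}" "g \<in> opspace \<O> 2" "h \<in> opspace \<O> 2" for j g h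
    using that x pcomp_sequential[of 1 2 j 2 1 g h x] by auto
  have s2: "pcomp \<O> 3 1 (j + 1) (pcomp \<O> 2 2 2 g h) x = pcomp \<O> 2 2 2 g (pcomp \<O> 2 1 j h x)"
    if "j \<in> {1,2}" "g \<in> opspace \<O> 2" "h \<in> opspace \<O> 2" for j g h
    using that x pcomp_sequential[of 2 2 j 2 1 g h x] by auto
  have p1: "pcomp \<O> 3 1 3 (pcomp \<O> 2 2 1 g h) x = pcomp \<O> 2 2 1 (pcomp \<O> 2 1 2 g x) h"
    if "g \<in> opspace \<O> 2" "h \<in> opspace \<O> 2" for g h
    using that x pcomp_parallel[of 1 2 2 2 1 g h x] by auto
  have p2: "pcomp \<O> 3 1 1 (pcomp \<O> 2 2 2 g h) x = pcomp \<O> 2 2 2 (pcomp \<O> 2 1 1 g x) h"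
    if "g \<in> opspace \<O> 2" "h \<in> opspace \<O> 2" for g h
    using that x pcomp_parallel[of 1 2 2 1 2 g x h] by auto
  have g: "operad_gamma \<O> f x x = pcomp \<O> 2 1 1 (pcomp \<O> 2 1 2 f x) x"
    by (simp add: operad_gamma_def)
  have g': "operad_gamma \<O> f x x = pcomp \<O> 2 1 2 (pcomp \<O> 2 1 1 f x) x"
    using f x by (simp add: operad_gamma_def pcomp_unary_unary_commute)
  \<comment> \<open>At the input that receives \<open>f'\<close>, the factor \<open>x\<close> moves
    onto \<open>f'\<close>, where \<open>eq\<close> turns it into \<gamma>(f; x, x).\<close>
  have u: "pcomp \<O> 2 2 i (pcomp \<O> 2 1 i h x) f' = pcomp \<O> 2 2 i h (operad_gamma \<O> f x x)"
    if "i \<in> {1,2}" "h \<in> opspace \<O> 2" for i h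
    using that x f' eq pcomp_unary_assoc_right[of x i 2 2 h f'] by auto
  have l: "pcomp \<O> 1 3 1 x (pcomp \<O> 2 2 i f' f') = pcomp \<O> 2 2 i (operad_gamma \<O> f x x) f'"
    if "i \<in> {1,2}" for i
    using that x f' eq pcomp_unary_assoc_left[of x i 2 2 f' f'] by auto
  have "pcomp \<O> 1 3 1 x (pcomp \<O> 2 2 1 f' f')
      = pcomp \<O> 2 2 1 (pcomp \<O> 2 1 2 f x) (operad_gamma \<O> f x x)"
    using l[of 1] u[of 1 "pcomp \<O> 2 1 2 f x"] c[of 2 f] f g by simp
  also have "\<dots> = T (pcomp \<O> 2 2 1 f f)"
    using p1[OF f f] s1[of 2 "pcomp \<O> 2 1 2 f x" f]
      s1[of 1 "pcomp \<O> 2 1 2 f x" "pcomp \<O> 2 1 2 f x"] f c[of 2 f] by (simp add: T_def g)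
  finally have 1: "pcomp \<O> 1 3 1 x (pcomp \<O> 2 2 1 f' f') = T (pcomp \<O> 2 2 1 f f)" .
  have "pcomp \<O> 1 3 1 x (pcomp \<O> 2 2 2 f' f')
      = pcomp \<O> 2 2 2 (pcomp \<O> 2 1 1 f x) (operad_gamma \<O> f x x)"
    using l[of 2] u[of 2 "pcomp \<O> 2 1 1 f x"] c[of 1 f] f g' by simp
  also have "\<dots> = T (pcomp \<O> 2 2 2 f f)"
    using s2[of 2 f f] s2[of 1 f "pcomp \<O> 2 1 2 f x"] p2[of f "operad_gamma \<O> f x x"]
      f c[of 2 f] gamma_closed[OF f x x] by (simp add: T_def g)
  finally have 2: "pcomp \<O> 1 3 1 x (pcomp \<O> 2 2 2 f' f') = T (pcomp \<O> 2 2 2 f f)" .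
  \<comment> \<open>The left inverse \<open>y\<close> makes postcomposition with \<open>x\<close>
    injective in arity 3, so associativity of \<open>f'\<close> can be tested after applying
    \<open>x\<close>.\<close>
  have inv: "pcomp \<O> 1 3 1 y (pcomp \<O> 1 3 1 x h) = h" if "h \<in> opspace \<O> 3" for h
    using that x y yx pcomp_unary_assoc_left[of y 1 1 3 x h] pcomp_opid_left[of 3 h] by simp
  have "pcomp \<O> 2 2 1 f f = pcomp \<O> 2 2 2 f f"
    using 0 by (simp add: circ_2_2)
  then have "pcomp \<O> 1 3 1 x (pcomp \<O> 2 2 1 f' f') = pcomp \<O> 1 3 1 x (pcomp \<O> 2 2 2 f' f')"
    using 1 2 by simp
  then have "pcomp \<O> 2 2 1 f' f' = pcomp \<O> 2 2 2 f' f'"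
    using inv[OF c3'[of 1]] inv[OF c3'[of 2]] by (metis insertCI)
  then show ?thesis
    by (simp add: circ_2_2)
qed

end

section \<open>Coefficientwise operations and the operad of power series\<close>

lemma fps_linear_ext_nth [simp]: "fps_nth (fps_linear_ext u F) k = u (fps_nth F k)"
  by (simp add: fps_linear_ext_def)

lemma fps_bilinear_ext_nth:
  "fps_nth (fps_bilinear_ext b F G) k = (\<Sum>i=0..k. b (fps_nth F i) (fps_nth G (k - i)))"
  by (simp add: fps_bilinear_ext_def)

lemma operad_fps_simps:
  "opscale (operad_fps \<O>) c = fps_linear_ext (opscale \<O> c)"
  "opspace (operad_fps \<O>) n = {F. \<forall>k. fps_nth F k \<in> opspace \<O> n}"
  "pcomp (operad_fps \<O>) m n i = fps_bilinear_ext (pcomp \<O> m n i)"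
  "opid (operad_fps \<O>) = fps_const (opid \<O>)"
  by (simp_all add: operad_fps_def)

lemma sum_antidiagonal_swap: "(\<Sum>i=0..n. u (n - i) i) = (\<Sum>i=0..n::nat. u i (n - i))"
  by (rule sum.reindex_bij_witness[of _ "\<lambda>i. n - i" "\<lambda>i. n - i"]) auto

lemma vector_space_fps:
  assumes "vector_space scl"
  shows "vector_space (\<lambda>c. fps_linear_ext (scl c))"
proof -
  interpret vector_space scl by fact
  show ?thesis
    by unfold_locales (auto simp: fps_eq_iff scale_right_distrib scale_left_distrib)
qed

text \<open>Bilinearity turns the coefficients of iterated compositions into sums over triples of
  indices, to which the axioms of \<O> apply term by term. This makes every lemma proved for operads
  available for \<O>[[t]].\<close>

lemma (in ns_operad) ns_operad_fps: "ns_operad (operad_fps \<O>)"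
proof -
  interpret F: vector_space "opscale (operad_fps \<O>)"
    using vector_space_fps[OF vector_space] by (simp add: operad_fps_def)
  note operad_fps_simps [simp]
  let ?P = "\<lambda>m n i. pcomp (operad_fps \<O>) m n i"
  show ?thesis
  proof
    show "F.subspace (opspace (operad_fps \<O>) n)" if "1 \<le> n" for n
      using that by (auto simp: F.subspace_def space_0 space_add space_scale)
    show "?P m n i f g \<in> opspace (operad_fps \<O>) (m + n - 1)"
      if "1 \<le> i" "i \<le> m" "1 \<le> n" "f \<in> opspace (operad_fps \<O>) m" "g \<in> opspace (operad_fps \<O>) n"
      for i m n f g
      using that by (auto simp: fps_bilinear_ext_nth intro!: space_sum pcomp_closed)
    show "?P m n i (f + f') g = ?P m n i f g + ?P m n i f' g"
      if "1 \<le> i" "i \<le> m" "1 \<le> n" "f \<in> opspace (operad_fps \<O>) m"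
        "f' \<in> opspace (operad_fps \<O>) m" "g \<in> opspace (operad_fps \<O>) n" for i m n f f' g
      using that by (simp add: fps_eq_iff fps_bilinear_ext_nth pcomp_add_left sum.distrib)
    show "?P m n i f (g + g') = ?P m n i f g + ?P m n i f g'"
      if "1 \<le> i" "i \<le> m" "1 \<le> n" "f \<in> opspace (operad_fps \<O>) m"
        "g \<in> opspace (operad_fps \<O>) n" "g' \<in> opspace (operad_fps \<O>) n" for i m n f g g'
      using that by (simp add: fps_eq_iff fps_bilinear_ext_nth pcomp_add_right sum.distrib)
    show "?P m n i (opscale (operad_fps \<O>) c f) g = opscale (operad_fps \<O>) c (?P m n i f g)"
      if "1 \<le> i" "i \<le> m" "1 \<le> n" "f \<in> opspace (operad_fps \<O>) m" "g \<in> opspace (operad_fps \<O>) n"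
      for i m n f g c
      using that by (simp add: fps_eq_iff fps_bilinear_ext_nth pcomp_scale_left scale_sum_right)
    show "?P m n i f (opscale (operad_fps \<O>) c g) = opscale (operad_fps \<O>) c (?P m n i f g)"
      if "1 \<le> i" "i \<le> m" "1 \<le> n" "f \<in> opspace (operad_fps \<O>) m" "g \<in> opspace (operad_fps \<O>) n"
      for i m n f g c
      using that by (simp add: fps_eq_iff fps_bilinear_ext_nth pcomp_scale_right scale_sum_right)
    show "?P (m + n - 1) p (i + j - 1) (?P m n i f g) h = ?P m (n + p - 1) i f (?P n p j g h)"
      if i: "1 \<le> i" "i \<le> m" and j: "1 \<le> j" "j \<le> n" and p: "1 \<le> p"
        and f: "f \<in> opspace (operad_fps \<O>) m" and g: "g \<in> opspace (operad_fps \<O>) n"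
        and h: "h \<in> opspace (operad_fps \<O>) p" for i m j n p f g h
    proof (rule fps_ext)
      fix k
      have "fps_nth (?P (m + n - 1) p (i + j - 1) (?P m n i f g) h) k
        = (\<Sum>a=0..k. \<Sum>b=0..a. pcomp \<O> (m + n - 1) p (i + j - 1)
            (pcomp \<O> m n i (fps_nth f b) (fps_nth g (a - b))) (fps_nth h (k - a)))"
        using i j p f g h
        by (simp add: fps_bilinear_ext_nth) (intro sum.cong pcomp_sum_left pcomp_closed refl, auto)
      also have "\<dots> = (\<Sum>a=0..k. \<Sum>b=0..a. pcomp \<O> m (n + p - 1) i (fps_nth f b)
            (pcomp \<O> n p j (fps_nth g (a - b)) (fps_nth h (k - a))))"
        using i j p f g h by (intro sum.cong refl pcomp_sequential) auto
      \<comment> \<open>The triples of indices with sum \<open>k\<close> are grouped by the first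
        index instead of by the last.\<close>
      also have "\<dots> = (\<Sum>a=0..k. \<Sum>b=0..k - a. pcomp \<O> m (n + p - 1) i (fps_nth f a)
            (pcomp \<O> n p j (fps_nth g b) (fps_nth h (k - a - b))))"
        by (rule fps_mult_assoc_lemma)
      also have "\<dots> = fps_nth (?P m (n + p - 1) i f (?P n p j g h)) k"
        using i j p f g h
        by (simp add: fps_bilinear_ext_nth)
          (intro sum.cong pcomp_sum_right[symmetric] pcomp_closed refl, auto)
      finally show "fps_nth (?P (m + n - 1) p (i + j - 1) (?P m n i f g) h) k
        = fps_nth (?P m (n + p - 1) i f (?P n p j g h)) k" .
    qed
    show "?P (m + n - 1) p (j + n - 1) (?P m n i f g) h = ?P (m + p - 1) n i (?P m p j f h) g"
      if i: "1 \<le> i" "i < j" and j: "j \<le> m" and n: "1 \<le> n" and p: "1 \<le> p"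
        and f: "f \<in> opspace (operad_fps \<O>) m" and g: "g \<in> opspace (operad_fps \<O>) n"
        and h: "h \<in> opspace (operad_fps \<O>) p" for i j m n p f g h
    proof (rule fps_ext)
      fix k
      have "fps_nth (?P (m + n - 1) p (j + n - 1) (?P m n i f g) h) k
        = (\<Sum>a=0..k. \<Sum>b=0..a. pcomp \<O> (m + n - 1) p (j + n - 1)
            (pcomp \<O> m n i (fps_nth f b) (fps_nth g (a - b))) (fps_nth h (k - a)))"
        using i j n p f g h
        by (simp add: fps_bilinear_ext_nth) (intro sum.cong pcomp_sum_left pcomp_closed refl, auto)
      also have "\<dots> = (\<Sum>a=0..k. \<Sum>b=0..a. pcomp \<O> (m + p - 1) n i
            (pcomp \<O> m p j (fps_nth f b) (fps_nth h (k - a))) (fps_nth g (a - b)))"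
        using i j n p f g h by (intro sum.cong refl pcomp_parallel) auto
      \<comment> \<open>Regrouping forwards, exchanging the last two indices and regrouping
        backwards makes \<open>g\<close> and \<open>h\<close> trade places in the triple
        sum.\<close>
      also have "\<dots> = (\<Sum>a=0..k. \<Sum>b=0..k - a. pcomp \<O> (m + p - 1) n i
            (pcomp \<O> m p j (fps_nth f a) (fps_nth h (k - a - b))) (fps_nth g b))"
        by (rule fps_mult_assoc_lemma)
      also have "\<dots> = (\<Sum>a=0..k. \<Sum>b=0..k - a. pcomp \<O> (m + p - 1) n i
            (pcomp \<O> m p j (fps_nth f a) (fps_nth h b)) (fps_nth g (k - a - b)))"
        by (intro sum.cong refl sum_antidiagonal_swap)
      also have "\<dots> = (\<Sum>a=0..k. \<Sum>b=0..a. pcomp \<O> (m + p - 1) n i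
            (pcomp \<O> m p j (fps_nth f b) (fps_nth h (a - b))) (fps_nth g (k - a)))"
        by (rule fps_mult_assoc_lemma[symmetric])
      also have "\<dots> = fps_nth (?P (m + p - 1) n i (?P m p j f h) g) k"
        using i j n p f g h
        by (simp add: fps_bilinear_ext_nth)
          (intro sum.cong pcomp_sum_left[symmetric] pcomp_closed refl, auto)
      finally show "fps_nth (?P (m + n - 1) p (j + n - 1) (?P m n i f g) h) k
        = fps_nth (?P (m + p - 1) n i (?P m p j f h) g) k" .
    qed
    show "opid (operad_fps \<O>) \<in> opspace (operad_fps \<O>) 1"
      by (simp add: opid_closed space_0)
    show "?P m 1 i f (opid (operad_fps \<O>)) = f"
      if "1 \<le> i" "i \<le> m" "f \<in> opspace (operad_fps \<O>) m" for i m f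
    proof (rule fps_ext)
      fix k
      have "(\<Sum>a=0..k. pcomp \<O> m 1 i (fps_nth f a) (fps_nth (fps_const (opid \<O>)) (k - a)))
          = (\<Sum>a=0..k. if a = k then fps_nth f k else 0)"
        using that by (intro sum.cong refl) (auto simp: pcomp_opid_right)
      then show "fps_nth (?P m 1 i f (opid (operad_fps \<O>))) k = fps_nth f k"
        by (simp add: fps_bilinear_ext_nth)
    qed
    show "?P 1 m 1 (opid (operad_fps \<O>)) f = f"
      if "1 \<le> m" "f \<in> opspace (operad_fps \<O>) m" for m f
    proof (rule fps_ext)
      fix k
      have "(\<Sum>a=0..k. pcomp \<O> 1 m 1 (fps_nth (fps_const (opid \<O>)) a) (fps_nth f (k - a)))
          = (\<Sum>a=0..k. if a = 0 then fps_nth f k else 0)"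
        using that by (intro sum.cong refl) (auto simp: pcomp_opid_left)
      then show "fps_nth (?P 1 m 1 (opid (operad_fps \<O>)) f) k = fps_nth f k"
        by (simp add: fps_bilinear_ext_nth)
    qed
  qed
qed


section \<open>Exponentials of operators raising the order\<close>

text \<open>Linearity is relative to \<open>W\<close> because operad compositions are known to be
  bilinear only on the spaces of the right arity.\<close>

definition linear_between ::
    "('k \<Rightarrow> 'b \<Rightarrow> 'b) \<Rightarrow> 'b::ab_group_add set \<Rightarrow> 'b set \<Rightarrow> ('b \<Rightarrow> 'b) \<Rightarrow> bool" where
  "linear_between scl W W' h \<longleftrightarrow> (\<forall>x\<in>W. h x \<in> W') \<and>
     (\<forall>x\<in>W. \<forall>y\<in>W. h (x + y) = h x + h y) \<and> (\<forall>c. \<forall>x\<in>W. h (scl c x) = scl c (h x))"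

lemma linear_betweenI:
  assumes "\<And>x. x \<in> W \<Longrightarrow> h x \<in> W'"
    and "\<And>x y. \<lbrakk>x \<in> W; y \<in> W\<rbrakk> \<Longrightarrow> h (x + y) = h x + h y"
    and "\<And>c x. x \<in> W \<Longrightarrow> h (scl c x) = scl c (h x)"
  shows "linear_between scl W W' h"
  using assms by (simp add: linear_between_def)

lemma linear_between_closed: "\<lbrakk>linear_between scl W W' h; x \<in> W\<rbrakk> \<Longrightarrow> h x \<in> W'"
  and linear_between_add:
    "\<lbrakk>linear_between scl W W' h; x \<in> W; y \<in> W\<rbrakk> \<Longrightarrow> h (x + y) = h x + h y"
  and linear_between_scale:
    "\<lbrakk>linear_between scl W W' h; x \<in> W\<rbrakk> \<Longrightarrow> h (scl c x) = scl c (h x)"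
  by (auto simp: linear_between_def)

lemma linear_between_funpow: "linear_between scl W W h \<Longrightarrow> linear_between scl W W (h ^^ n)"
  by (induction n) (auto simp: linear_between_def)

text \<open>Membership of the iterates is part of the claim since the intertwining relation is
  available on \<open>W\<close> only, and the induction has to use it there.\<close>

lemma funpow_commute_on:
  assumes "\<And>x. x \<in> W \<Longrightarrow> A x \<in> W" "\<And>x. x \<in> W \<Longrightarrow> B x \<in> W"
    and "\<And>x. x \<in> W \<Longrightarrow> h (A x) = B (h x)" and "x \<in> W"
  shows "h ((A ^^ n) x) = (B ^^ n) (h x) \<and> (A ^^ n) x \<in> W"
  using assms by (induction n) auto

locale char_0_vector_space = vector_space scale
  for scale :: "'k::field_char_0 \<Rightarrow> 'b::ab_group_add \<Rightarrow> 'b" (infixr "*s" 75)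
begin

lemma linear_between_0:
  assumes "linear_between scale W W' h" "subspace W"
  shows "h 0 = 0"
  using linear_between_scale[OF assms(1) subspace_0[OF assms(2)], of 0] by simp

lemma linear_between_diff:
  assumes h: "linear_between scale W W' h" and W: "subspace W" and xy: "x \<in> W" "y \<in> W"
  shows "h (x - y) = h x - h y"
  using linear_between_add[OF h subspace_diff[OF W xy] xy(2)] by simp

lemma linear_between_sum:
  assumes h: "linear_between scale W W' h" and W: "subspace W" and "\<And>s. s \<in> S \<Longrightarrow> f s \<in> W"
  shows "h (\<Sum>s\<in>S. f s) = (\<Sum>s\<in>S. h (f s))"
  using assms(3)
proof (induction S rule: infinite_finite_induct)
  case (insert s S)
  then show ?case
    by (simp add: linear_between_add[OF h] subspace_sum[OF W])
qed (simp_all add: linear_between_0[OF h W])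

lemma linear_between_plus:
  assumes "linear_between scale W W' A" "linear_between scale W W' B" "subspace W'"
  shows "linear_between scale W W' (\<lambda>x. A x + B x)"
  using assms by (auto simp: linear_between_def subspace_add scale_right_distrib)

text \<open>The binomial theorem for commuting operators; with divided powers the binomial
  coefficients disappear. In the induction step \<open>A\<close> and \<open>B\<close> each raise one
  index of \<open>E i j\<close> at the cost of the new index as a factor, and on the antidiagonal
  these factors add up to \<open>Suc n\<close>.\<close>

lemma divided_power_add:
  assumes W: "subspace W" and A: "linear_between scale W W A" and B: "linear_between scale W W B"
    and comm: "\<And>x. x \<in> W \<Longrightarrow> B (A x) = A (B x)" and x: "x \<in> W"
  shows "(1 / fact n) *s ((\<lambda>x. A x + B x) ^^ n) x
    = (\<Sum>i=0..n. (1 / (fact i * fact (n - i))) *s (A ^^ i) ((B ^^ (n - i)) x))"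
proof (induction n)
  case (Suc n)
  define T where "T = (\<lambda>x. A x + B x)"
  define E where "E i j = (1 / (fact i * fact j)) *s (A ^^ i) ((B ^^ j) x)" for i j
  have T: "linear_between scale W W T"
    unfolding T_def by (intro linear_between_plus A B W)
  have Bx: "(B ^^ j) x \<in> W" for j
    using linear_between_closed[OF linear_between_funpow[OF B]] x by blast
  have ABx: "(A ^^ i) ((B ^^ j) x) \<in> W" for i j
    using linear_between_closed[OF linear_between_funpow[OF A]] Bx by blast
  have E: "E i j \<in> W" for i j
    unfolding E_def by (intro subspace_scale W ABx)
  have AE: "A (E i j) = of_nat (Suc i) *s E (Suc i) j" for i j
    unfolding E_def by (simp add: linear_between_scale[OF A] ABx field_simps del: of_nat_Suc)
  have BE: "B (E i j) = of_nat (Suc j) *s E i (Suc j)" for i j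
  proof -
    have "B ((A ^^ i) ((B ^^ j) x)) = (A ^^ i) (B ((B ^^ j) x))"
      using funpow_commute_on[of W A A B] linear_between_closed[OF A] comm Bx by blast
    then show ?thesis
      unfolding E_def by (simp add: linear_between_scale[OF B] ABx field_simps del: of_nat_Suc)
  qed
  \<comment> \<open>The factor \<open>Suc n\<close> is kept on both sides and cancelled at the end,
    which characteristic 0 permits.\<close>
  have "of_nat (Suc n) *s (1 / fact (Suc n)) *s (T ^^ Suc n) x = T ((1 / fact n) *s (T ^^ n) x)"
    using linear_between_closed[OF linear_between_funpow[OF T] x]
    by (simp add: linear_between_scale[OF T] field_simps del: of_nat_Suc)
  also have "(1 / fact n) *s (T ^^ n) x = (\<Sum>i=0..n. E i (n - i))"
    using Suc.IH by (simp add: T_def E_def)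
  also have "T \<dots> = (\<Sum>i=0..n. A (E i (n - i))) + (\<Sum>i=0..n. B (E i (n - i)))"
    by (simp add: linear_between_sum[OF T W] E) (simp add: T_def sum.distrib)
  \<comment> \<open>Both sums are extended to \<open>0..Suc n\<close>: the added term has factor 0,
    at \<open>i = 0\<close> for \<open>A\<close> and at \<open>i = Suc n\<close> for
    \<open>B\<close>.\<close>
  also have "(\<Sum>i=0..n. A (E i (n - i))) = (\<Sum>i=0..Suc n. of_nat i *s E i (Suc n - i))"
    unfolding AE by (subst sum.atLeast0_atMost_Suc_shift) simp
  also have "(\<Sum>i=0..n. B (E i (n - i))) = (\<Sum>i=0..Suc n. of_nat (Suc n - i) *s E i (Suc n - i))"
    unfolding BE by (simp add: Suc_diff_le add_diff_eq)
  also have "(\<Sum>i=0..Suc n. of_nat i *s E i (Suc n - i)) + \<dots>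
      = (\<Sum>i=0..Suc n. of_nat (Suc n) *s E i (Suc n - i))"
    unfolding sum.distrib[symmetric]
    by (intro sum.cong refl)
      (simp flip: scale_left_distrib of_nat_add del: of_nat_Suc)
  also have "\<dots> = of_nat (Suc n) *s (\<Sum>i=0..Suc n. E i (Suc n - i))"
    by (simp only: scale_sum_right)
  finally show ?case
    using of_nat_neq_0[of n, where 'a='k] unfolding T_def E_def by (simp only: scale_cancel_left) auto
qed simp

end

section \<open>t-adic convergence and exponentials of filtered operators\<close>

text \<open>Since \<open>f n\<close> is divisible by t^n, coefficient \<open>k\<close> of the
  partial sums is constant from \<open>Suc k\<close> summands on.\<close>

lemma sums_fps:
  fixes f :: "nat \<Rightarrow> 'b::ab_group_add fps"
  assumes "\<And>n k. k < n \<Longrightarrow> f n $ k = 0"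
  shows "f sums Abs_fps (\<lambda>k. \<Sum>n=0..k. f n $ k)"
  unfolding sums_def tendsto_fps_iff eventually_sequentially
proof (intro allI exI impI)
  fix k N :: nat
  assume "Suc k \<le> N"
  then show "(\<Sum>n<N. f n) $ k = Abs_fps (\<lambda>k. \<Sum>n=0..k. f n $ k) $ k"
    unfolding fps_sum_nth using assms by (auto intro!: sum.mono_neutral_right)
qed

definition fps_carrier :: "'b set \<Rightarrow> 'b fps set" where
  "fps_carrier W = {F. \<forall>k. F $ k \<in> W}"

context char_0_vector_space
begin

abbreviation fscale :: "'k \<Rightarrow> 'b fps \<Rightarrow> 'b fps" where
  "fscale c \<equiv> fps_linear_ext (scale c)"

lemma char_0_vector_space_fps: "char_0_vector_space fscale"
  unfolding char_0_vector_space_def by (rule vector_space_fps) unfold_locales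

lemma subspace_fps_carrier: "subspace W \<Longrightarrow> module.subspace fscale (fps_carrier W)"
proof -
  assume W: "subspace W"
  interpret F: char_0_vector_space fscale by (rule char_0_vector_space_fps)
  show ?thesis
    using W by (auto simp: F.subspace_def fps_carrier_def subspace_0 subspace_add subspace_scale)
qed

text \<open>\<open>r\<close> counts the powers of t gained: multiples of t^k go to multiples of
  t^(k+r). Operators with \<open>r = 1\<close> can be exponentiated; maps with \<open>r = 0\<close>
  are continuous enough to pass through the exponential series.\<close>

definition filtered :: "nat \<Rightarrow> 'b set \<Rightarrow> 'b set \<Rightarrow> ('b fps \<Rightarrow> 'b fps) \<Rightarrow> bool" where
  "filtered r W W' h \<longleftrightarrow> linear_between fscale (fps_carrier W) (fps_carrier W') h \<and>
     (\<forall>F \<in> fps_carrier W. \<forall>k. (\<forall>j<k. F $ j = 0) \<longrightarrow> (\<forall>j<k + r. h F $ j = 0))"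

lemma filtered_linear:
  "filtered r W W' h \<Longrightarrow> linear_between fscale (fps_carrier W) (fps_carrier W') h"
  by (simp add: filtered_def)

lemma filtered_closed: "\<lbrakk>filtered r W W' h; F \<in> fps_carrier W\<rbrakk> \<Longrightarrow> h F \<in> fps_carrier W'"
  using filtered_linear linear_between_closed by blast

lemma filtered_nth_eq_0:
  "\<lbrakk>filtered r W W' h; F \<in> fps_carrier W; \<And>i. i < k \<Longrightarrow> F $ i = 0; j < k + r\<rbrakk> \<Longrightarrow> h F $ j = 0"
  by (auto simp: filtered_def)

text \<open>Apply the filtration to \<open>F - G\<close>. This takes the place of continuity
  arguments: an infinite series may be truncated before \<open>h\<close> is applied to it.\<close>

lemma filtered_nth_cong:
  assumes h: "filtered r W W' h" and W: "subspace W"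
    and FG: "F \<in> fps_carrier W" "G \<in> fps_carrier W"
    and eq: "\<And>i. i < k \<Longrightarrow> F $ i = G $ i" and j: "j < k + r"
  shows "h F $ j = h G $ j"
proof -
  interpret F: char_0_vector_space fscale by (rule char_0_vector_space_fps)
  have W': "F.subspace (fps_carrier W)" by (rule subspace_fps_carrier[OF W])
  have "h (F - G) $ j = 0"
    using filtered_nth_eq_0[OF h F.subspace_diff[OF W' FG] _ j] eq by simp
  then show ?thesis
    by (simp add: F.linear_between_diff[OF filtered_linear[OF h] W' FG])
qed

lemma filtered_plus:
  assumes "filtered r W W' A" "filtered r W W' B" "subspace W'"
  shows "filtered r W W' (\<lambda>F. A F + B F)"
proof -
  interpret F: char_0_vector_space fscale by (rule char_0_vector_space_fps)
  show ?thesis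
    using assms F.linear_between_plus[OF _ _ subspace_fps_carrier]
    by (simp add: filtered_def)
qed

lemma filtered_funpow:
  assumes "filtered 1 W W T"
  shows "filtered n W W (T ^^ n)"
proof (induction n)
  case (Suc n)
  have "(T ^^ Suc n) F $ j = 0"
    if "F \<in> fps_carrier W" "\<forall>i<k. F $ i = 0" "j < k + Suc n" for F k j
    using filtered_nth_eq_0[OF assms filtered_closed[OF Suc], of F "k + n" j]
      filtered_nth_eq_0[OF Suc, of F k] that by simp
  then show ?case
    using linear_between_funpow[OF filtered_linear[OF assms], of "Suc n"]
    by (simp add: filtered_def del: funpow.simps)
qed (auto simp: filtered_def linear_between_def)

definition exp_op :: "('b fps \<Rightarrow> 'b fps) \<Rightarrow> 'b fps \<Rightarrow> 'b fps" where
  "exp_op T F = (\<Sum>n. fscale (1 / fact n) ((T ^^ n) F))"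

context
  fixes W T
  assumes W: "subspace W" and T: "filtered 1 W W T"
begin

lemma funpow_closed: "F \<in> fps_carrier W \<Longrightarrow> (T ^^ n) F \<in> fps_carrier W"
  using filtered_closed[OF filtered_funpow[OF T]] .

lemma funpow_nth_eq_0: "\<lbrakk>F \<in> fps_carrier W; k < n\<rbrakk> \<Longrightarrow> (T ^^ n) F $ k = 0"
  using filtered_nth_eq_0[OF filtered_funpow[OF T], of F 0 k n] by simp

lemma exp_op_sums:
  assumes "F \<in> fps_carrier W"
  shows "(\<lambda>n. fscale (1 / fact n) ((T ^^ n) F)) sums exp_op T F"
  unfolding exp_op_def using assms
  by (intro summable_sums sums_summable[OF sums_fps]) (simp add: funpow_nth_eq_0)

text \<open>The terms with \<open>n > k\<close> do not reach coefficient \<open>k\<close>. The bound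
  \<open>N\<close> is left free so that one truncation serves all coefficients up to
  \<open>N\<close>.\<close>

lemma exp_op_nth:
  assumes F: "F \<in> fps_carrier W" and "k \<le> N"
  shows "exp_op T F $ k = (\<Sum>n=0..N. (1 / fact n) *s (T ^^ n) F $ k)"
proof -
  have "exp_op T F = Abs_fps (\<lambda>k. \<Sum>n=0..k. fscale (1 / fact n) ((T ^^ n) F) $ k)"
    using F exp_op_sums[OF F]
    by (intro sums_unique2[OF _ sums_fps]) (simp_all add: funpow_nth_eq_0)
  then have "exp_op T F $ k = (\<Sum>n=0..k. (1 / fact n) *s (T ^^ n) F $ k)"
    by simp
  also have "\<dots> = (\<Sum>n=0..N. (1 / fact n) *s (T ^^ n) F $ k)"
    using assms by (intro sum.mono_neutral_left) (auto simp: funpow_nth_eq_0)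
  finally show ?thesis .
qed

lemma exp_op_closed: "F \<in> fps_carrier W \<Longrightarrow> exp_op T F \<in> fps_carrier W"
  using funpow_closed
  by (auto simp: fps_carrier_def exp_op_nth[OF _ order_refl] intro!: subspace_sum subspace_scale W)

end

lemma exp_op_cong:
  assumes "filtered 1 W W T" "\<And>F. F \<in> fps_carrier W \<Longrightarrow> T' F = T F" "F \<in> fps_carrier W"
  shows "exp_op T' F = exp_op T F"
proof -
  have "(T' ^^ n) F = (T ^^ n) F \<and> (T ^^ n) F \<in> fps_carrier W" for n
    using assms filtered_closed[OF assms(1)] by (induction n) auto
  then show ?thesis
    by (simp add: exp_op_def)
qed

lemma exp_op_zero: "exp_op (\<lambda>F. 0) F = F"
proof -
  have "((\<lambda>F. 0) ^^ n) F = (if n = 0 then F else 0)" for n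
    by (cases n) auto
  then have "(\<lambda>n. fscale (1 / fact n) (((\<lambda>F. 0) ^^ n) F)) = (\<lambda>n. if n = 0 then F else 0)"
    by (auto simp: fun_eq_iff fps_eq_iff)
  then show ?thesis
    using sums_unique[OF sums_single[of 0 "\<lambda>n. F"]] by (simp add: exp_op_def)
qed

text \<open>Coefficient \<open>k\<close> on either side depends only on the partial sum
  \<open>G\<close> up to \<open>k\<close>. For a finite sum, linearity of \<open>h\<close> and the
  iterated relation between \<open>T\<close> and \<open>T'\<close> suffice.\<close>

lemma exp_op_intertwine:
  assumes W: "subspace W" and W': "subspace W'"
    and T: "filtered 1 W W T" and T': "filtered 1 W' W' T'" and h: "filtered 0 W W' h"
    and hT: "\<And>F. F \<in> fps_carrier W \<Longrightarrow> h (T F) = T' (h F)" and F: "F \<in> fps_carrier W"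
  shows "h (exp_op T F) = exp_op T' (h F)"
proof (rule fps_ext)
  fix k
  interpret F: char_0_vector_space fscale by (rule char_0_vector_space_fps)
  note S = subspace_fps_carrier[OF W]
  have c: "(T ^^ n) F \<in> fps_carrier W" for n
    using funpow_closed[OF W T F] .
  have h_pow: "h ((T ^^ n) F) = (T' ^^ n) (h F)" for n
    using c hT by (induction n) auto
  define G where "G = (\<Sum>n=0..k. fscale (1 / fact n) ((T ^^ n) F))"
  have G: "G \<in> fps_carrier W"
    unfolding G_def by (intro F.subspace_sum F.subspace_scale S c)
  have "h (exp_op T F) $ k = h G $ k"
    using exp_op_nth[OF W T F]
    by (intro filtered_nth_cong[OF h W exp_op_closed[OF W T F] G, of "Suc k"])
      (simp_all add: G_def fps_sum_nth)
  also have "h G = (\<Sum>n=0..k. fscale (1 / fact n) ((T' ^^ n) (h F)))"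
    unfolding G_def using c h_pow
    by (simp add: F.linear_between_sum[OF filtered_linear[OF h] S] F.subspace_scale[OF S]
        linear_between_scale[OF filtered_linear[OF h]])
  also have "\<dots> $ k = exp_op T' (h F) $ k"
    using exp_op_nth[OF W' T' filtered_closed[OF h F] order_refl] by (simp add: fps_sum_nth)
  finally show "h (exp_op T F) $ k = exp_op T' (h F) $ k" .
qed

text \<open>The rule e^(A+B) = e^A e^B for commuting operators: by the binomial theorem the left
  side is a sum of the terms \<open>E i j\<close> over a triangle of indices, while the product on
  the right is a sum over a square.\<close>

lemma exp_op_plus:
  assumes W: "subspace W" and A: "filtered 1 W W A" and B: "filtered 1 W W B"
    and comm: "\<And>F. F \<in> fps_carrier W \<Longrightarrow> B (A F) = A (B F)" and F: "F \<in> fps_carrier W"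
  shows "exp_op (\<lambda>F. A F + B F) F = exp_op A (exp_op B F)"
proof (rule fps_ext)
  fix N
  interpret F: char_0_vector_space fscale by (rule char_0_vector_space_fps)
  note S = subspace_fps_carrier[OF W]
  define E where "E i j = fscale (1 / (fact i * fact j)) ((A ^^ i) ((B ^^ j) F))" for i j
  define G where "G = (\<Sum>n=0..N. fscale (1 / fact n) ((B ^^ n) F))"
  have c: "(B ^^ n) F \<in> fps_carrier W" for n
    using funpow_closed[OF W B F] .
  have G: "G \<in> fps_carrier W"
    unfolding G_def by (intro F.subspace_sum F.subspace_scale S c)
  have AG: "(1 / fact i) *s (A ^^ i) (exp_op B F) $ N = (\<Sum>j=0..N. E i j $ N)" for i
  proof -
    note Ai = filtered_funpow[OF A, of i]
    have "(A ^^ i) (exp_op B F) $ N = (A ^^ i) G $ N"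
      using exp_op_nth[OF W B F]
      by (intro filtered_nth_cong[OF Ai W exp_op_closed[OF W B F] G, of "Suc N"])
        (simp_all add: G_def fps_sum_nth)
    also have "(A ^^ i) G = (\<Sum>j=0..N. fscale (1 / fact j) ((A ^^ i) ((B ^^ j) F)))"
      unfolding G_def using c
      by (simp add: F.linear_between_sum[OF filtered_linear[OF Ai] S] F.subspace_scale[OF S]
          linear_between_scale[OF filtered_linear[OF Ai]])
    finally show ?thesis
      by (simp add: E_def fps_sum_nth scale_sum_right)
  qed
  have E0: "E i j $ N = 0" if "N < i + j" for i j
  proof -
    have "(A ^^ i) ((B ^^ j) F) $ N = 0"
      using filtered_nth_eq_0[OF filtered_funpow[OF A] c, of j j N i]
        funpow_nth_eq_0[OF W B F] that by simp
    then show ?thesis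
      by (simp add: E_def)
  qed
  have "exp_op (\<lambda>F. A F + B F) F $ N
      = (\<Sum>n=0..N. fscale (1 / fact n) (((\<lambda>F. A F + B F) ^^ n) F) $ N)"
    using exp_op_nth[OF W filtered_plus[OF A B W] F order_refl] by simp
  also have "\<dots> = (\<Sum>n=0..N. \<Sum>i=0..n. E i (n - i) $ N)"
    using F.divided_power_add[OF S filtered_linear[OF A] filtered_linear[OF B] comm F]
    by (simp add: E_def fps_sum_nth)
  also have "\<dots> = (\<Sum>(i, j)\<in>{(i, j). i + j \<le> N}. E i j $ N)"
    by (simp add: sum.triangle_reindex_eq atLeast0AtMost)
  \<comment> \<open>The triangle may be enlarged to the square because \<open>E i j\<close> is
    divisible by t^(i+j), so it has no coefficient at \<open>N\<close> outside the triangle.\<close>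
  also have "\<dots> = (\<Sum>(i, j)\<in>{0..N} \<times> {0..N}. E i j $ N)"
    by (intro sum.mono_neutral_left) (auto, metis E0 not_le)
  also have "\<dots> = (\<Sum>i=0..N. (1 / fact i) *s (A ^^ i) (exp_op B F) $ N)"
    by (simp add: AG sum.cartesian_product)
  also have "\<dots> = exp_op A (exp_op B F) $ N"
    using exp_op_nth[OF W A exp_op_closed[OF W B F] order_refl] by simp
  finally show "exp_op (\<lambda>F. A F + B F) F $ N = exp_op A (exp_op B F) $ N" .
qed

end

section \<open>Fixed points of t-adic contractions\<close>

text \<open>Banach's argument in the t-adic metric: each iteration makes one more coefficient final,
  and the fixed point is read off along the diagonal of the iterates. Since \<open>S\<close> is
  given by a condition on each coefficient separately, it contains this limit.\<close>

lemma fps_contraction_fixpoint: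
  fixes \<Psi> :: "'b::zero fps \<Rightarrow> 'b fps"
  assumes S: "S = {F. \<forall>k. Q k (F $ k)}" and F0: "F0 \<in> S"
    and closed: "\<And>F. F \<in> S \<Longrightarrow> \<Psi> F \<in> S"
    and contr: "\<And>F G k. \<lbrakk>F \<in> S; G \<in> S; \<And>j. j < k \<Longrightarrow> F $ j = G $ j\<rbrakk> \<Longrightarrow> \<Psi> F $ k = \<Psi> G $ k"
  shows "\<exists>F\<in>S. \<Psi> F = F"
proof -
  define z where "z n = (\<Psi> ^^ n) F0" for n
  have z: "z n \<in> S" for n
    unfolding z_def using F0 closed by (induction n) auto
  have zS: "z (Suc n) = \<Psi> (z n)" for n
    by (simp add: z_def)
  have step: "k < n \<Longrightarrow> z (Suc n) $ k = z n $ k" for n k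
  proof (induction n arbitrary: k)
    case (Suc n)
    show ?case
      unfolding zS[of "Suc n"] unfolding zS[of n] using Suc zS by (intro contr z closed) auto
  qed simp
  have stable: "k < n \<Longrightarrow> z n $ k = z (Suc k) $ k" for n k
  proof (induction n)
    case (Suc n)
    then show ?case
      using step[of k n] by (cases "k = n") auto
  qed simp
  define F where "F = Abs_fps (\<lambda>k. z (Suc k) $ k)"
  have F: "F \<in> S"
    using z S by (simp add: F_def)
  have "\<Psi> F $ k = \<Psi> (z k) $ k" for k
    using stable[of _ k] by (intro contr F z) (simp add: F_def)
  then have "\<Psi> F $ k = F $ k" for k
    by (simp add: F_def zS)
  then show ?thesis
    using F by (auto simp: fps_eq_iff)
qed


section \<open>Gauge equivalence and equivalence of deformations\<close>

context ns_operad
begin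

sublocale char_0_vector_space "opscale \<O>"
  by unfold_locales

abbreviation \<O>\<^sub>t where "\<O>\<^sub>t \<equiv> operad_fps \<O>"

interpretation F: ns_operad "\<O>\<^sub>t"
  by (rule ns_operad_fps)

lemma fps_carrier_opspace: "fps_carrier (opspace \<O> n) = opspace \<O>\<^sub>t n"
  by (simp add: fps_carrier_def operad_fps_simps)

lemma opspace_fps_nth: "F \<in> opspace \<O>\<^sub>t n \<Longrightarrow> F $ k \<in> opspace \<O> n"
  by (simp add: operad_fps_simps)

lemma pcomp_fps_nth:
  "pcomp \<O>\<^sub>t m n i f g $ k = (\<Sum>a=0..k. pcomp \<O> m n i (f $ a) (g $ (k - a)))"
  by (simp add: operad_fps_simps fps_bilinear_ext_nth)

text \<open>Orders add under composition: two indices with sum below \<open>k + l\<close> cannot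
  satisfy both lower bounds.\<close>

lemma pcomp_fps_nth_eq_0:
  assumes i: "1 \<le> i" "i \<le> m" "1 \<le> n" and fg: "f \<in> opspace \<O>\<^sub>t m" "g \<in> opspace \<O>\<^sub>t n"
    and 0: "\<And>j. j < k \<Longrightarrow> f $ j = 0" "\<And>j. j < l \<Longrightarrow> g $ j = 0" and s: "s < k + l"
  shows "pcomp \<O>\<^sub>t m n i f g $ s = 0"
  unfolding pcomp_fps_nth
proof (rule sum.neutral, rule ballI)
  fix a assume "a \<in> {0..s}"
  then have "a < k \<or> s - a < l"
    using s by auto
  then show "pcomp \<O> m n i (f $ a) (g $ (s - a)) = 0"
    using i fg 0 by (auto simp: opspace_fps_nth)
qed

text \<open>The gain \<open>r\<close> is the order of the argument held fixed: \<open>r = 1\<close>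
  when composing with an element of L in degree 0, and \<open>r = 0\<close> for the intertwining
  maps.\<close>

lemma filtered_pcomp_left:
  assumes "1 \<le> i" "i \<le> m" "1 \<le> n" "g \<in> opspace \<O>\<^sub>t n" "\<And>j. j < r \<Longrightarrow> g $ j = 0"
  shows "filtered r (opspace \<O> m) (opspace \<O> (m + n - 1)) (\<lambda>f. pcomp \<O>\<^sub>t m n i f g)"
proof -
  have "pcomp \<O>\<^sub>t m n i F g $ j = 0" if "F \<in> opspace \<O>\<^sub>t m" "\<forall>j<k. F $ j = 0" "j < k + r" for F k j
    using assms that by (intro pcomp_fps_nth_eq_0[of i m n _ _ k r]) auto
  then show ?thesis
    using assms F.pcomp_closed F.pcomp_add_left F.pcomp_scale_left
    unfolding filtered_def fps_carrier_opspace
    by (auto intro!: linear_betweenI simp: operad_fps_simps(1))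
qed

lemma filtered_pcomp_right:
  assumes "1 \<le> i" "i \<le> m" "1 \<le> n" "f \<in> opspace \<O>\<^sub>t m" "\<And>j. j < r \<Longrightarrow> f $ j = 0"
  shows "filtered r (opspace \<O> n) (opspace \<O> (m + n - 1)) (\<lambda>g. pcomp \<O>\<^sub>t m n i f g)"
proof -
  have "pcomp \<O>\<^sub>t m n i f F $ j = 0" if "F \<in> opspace \<O>\<^sub>t n" "\<forall>j<k. F $ j = 0" "j < k + r" for F k j
    using assms that by (intro pcomp_fps_nth_eq_0[of i m n _ _ r k]) auto
  then show ?thesis
    using assms F.pcomp_closed F.pcomp_add_right F.pcomp_scale_right
    unfolding filtered_def fps_carrier_opspace
    by (auto intro!: linear_betweenI simp: operad_fps_simps(1))
qed

section \<open>The exponential in the algebra \<O>(1)[[t]]\<close>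

definition fps_exp :: "'a fps \<Rightarrow> 'a fps" where
  "fps_exp x = exp_op (pcomp \<O>\<^sub>t 1 1 1 x) (opid \<O>\<^sub>t)"

context
  fixes x assumes x: "x \<in> opspace \<O>\<^sub>t 1" "x $ 0 = 0"
begin

lemma filtered_left_mult:
  "1 \<le> m \<Longrightarrow> filtered 1 (opspace \<O> m) (opspace \<O> m) (pcomp \<O>\<^sub>t 1 m 1 x)"
  using filtered_pcomp_right[of 1 1 m x 1] x by simp

lemma filtered_right_mult:
  "\<lbrakk>1 \<le> i; i \<le> m\<rbrakk> \<Longrightarrow> filtered 1 (opspace \<O> m) (opspace \<O> m) (\<lambda>f. pcomp \<O>\<^sub>t m 1 i f x)"
  using filtered_pcomp_left[of i m 1 x 1] x by simp

lemma fps_exp_closed: "fps_exp x \<in> opspace \<O>\<^sub>t 1"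
  using exp_op_closed[OF subspace filtered_left_mult, of 1 "opid \<O>\<^sub>t"] F.opid_closed
  by (simp add: fps_exp_def fps_carrier_opspace)

lemma fps_exp_nth:
  "k \<le> N \<Longrightarrow> fps_exp x $ k
    = (\<Sum>n=0..N. opscale \<O> (1 / fact n) ((pcomp \<O>\<^sub>t 1 1 1 x ^^ n) (opid \<O>\<^sub>t) $ k))"
  unfolding fps_exp_def using F.opid_closed
  by (intro exp_op_nth[OF subspace filtered_left_mult]) (simp_all add: fps_carrier_opspace)

lemma fps_exp_nth_0: "fps_exp x $ 0 = opid \<O>"
  using fps_exp_nth[of 0 0] by (simp add: operad_fps_simps)

text \<open>The map sending \<open>y\<close> to \<open>y\<close> composed with \<open>f\<close>
  intertwines left multiplication by \<open>x\<close> on \<O>(1)[[t]] with postcomposition by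
  \<open>x\<close> in arity \<open>m\<close>; evaluate at the identity.\<close>

lemma exp_left_mult:
  assumes f: "1 \<le> m" "f \<in> opspace \<O>\<^sub>t m"
  shows "exp_op (pcomp \<O>\<^sub>t 1 m 1 x) f = pcomp \<O>\<^sub>t 1 m 1 (fps_exp x) f"
proof -
  have "pcomp \<O>\<^sub>t 1 m 1 (fps_exp x) f = exp_op (pcomp \<O>\<^sub>t 1 m 1 x) (pcomp \<O>\<^sub>t 1 m 1 (opid \<O>\<^sub>t) f)"
    unfolding fps_exp_def
  proof (rule exp_op_intertwine[OF subspace subspace filtered_left_mult filtered_left_mult])
    show "filtered 0 (opspace \<O> 1) (opspace \<O> m) (\<lambda>y. pcomp \<O>\<^sub>t 1 m 1 y f)"
      using filtered_pcomp_left[of 1 1 m f 0] f by simp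
    show "pcomp \<O>\<^sub>t 1 m 1 (pcomp \<O>\<^sub>t 1 1 1 x y) f = pcomp \<O>\<^sub>t 1 m 1 x (pcomp \<O>\<^sub>t 1 m 1 y f)"
      if "y \<in> fps_carrier (opspace \<O> 1)" for y
      using that f x F.pcomp_unary_assoc_left[of x 1 1 m y f] by (simp add: fps_carrier_opspace)
  qed (use f F.opid_closed in \<open>simp_all add: fps_carrier_opspace\<close>)
  then show ?thesis
    using f by (simp add: F.pcomp_opid_left)
qed

text \<open>\<open>x\<close> commutes with its own powers, so left and right multiplication generate
  the same powers from the identity. Inserting into an input of \<open>f\<close> intertwines right
  multiplication, hence this form is the one needed for inputs.\<close>

lemma fps_exp_eq_right: "fps_exp x = exp_op (\<lambda>y. pcomp \<O>\<^sub>t 1 1 1 y x) (opid \<O>\<^sub>t)"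
proof -
  let ?p = "\<lambda>n. (pcomp \<O>\<^sub>t 1 1 1 x ^^ n) (opid \<O>\<^sub>t)"
  have p: "?p n \<in> opspace \<O>\<^sub>t 1" for n
    using x F.opid_closed F.pcomp_unary_left by (induction n) auto
  have comm: "pcomp \<O>\<^sub>t 1 1 1 (?p n) x = ?p (Suc n)" for n
  proof (induction n)
    case (Suc n)
    then show ?case
      using x p[of n] F.pcomp_unary_assoc_left[of x 1 1 1 "?p n" x]
      by (simp add: One_nat_def[symmetric])
  qed (use x in \<open>simp add: F.pcomp_opid_left F.pcomp_opid_right\<close>)
  have "((\<lambda>y. pcomp \<O>\<^sub>t 1 1 1 y x) ^^ n) (opid \<O>\<^sub>t) = ?p n" for n
    by (induction n) (use comm in auto)
  then show ?thesis
    by (simp add: fps_exp_def exp_op_def)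
qed

lemma exp_right_mult:
  assumes i: "1 \<le> i" "i \<le> m" and f: "f \<in> opspace \<O>\<^sub>t m"
  shows "exp_op (\<lambda>f. pcomp \<O>\<^sub>t m 1 i f x) f = pcomp \<O>\<^sub>t m 1 i f (fps_exp x)"
proof -
  have "pcomp \<O>\<^sub>t m 1 i f (fps_exp x)
      = exp_op (\<lambda>f. pcomp \<O>\<^sub>t m 1 i f x) (pcomp \<O>\<^sub>t m 1 i f (opid \<O>\<^sub>t))"
    unfolding fps_exp_eq_right
  proof (rule exp_op_intertwine[OF subspace subspace filtered_right_mult filtered_right_mult])
    show "filtered 0 (opspace \<O> 1) (opspace \<O> m) (\<lambda>y. pcomp \<O>\<^sub>t m 1 i f y)"
      using filtered_pcomp_right[of i m 1 f 0] i f by simp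
    show "pcomp \<O>\<^sub>t m 1 i f (pcomp \<O>\<^sub>t 1 1 1 y x) = pcomp \<O>\<^sub>t m 1 i (pcomp \<O>\<^sub>t m 1 i f y) x"
      if "y \<in> fps_carrier (opspace \<O> 1)" for y
      using that i f x F.pcomp_unary_assoc_right[of y i m 1 f x] by (simp add: fps_carrier_opspace)
  qed (use i f F.opid_closed in \<open>simp_all add: fps_carrier_opspace\<close>)
  then show ?thesis
    using i f by (simp add: F.pcomp_opid_right)
qed

end

lemma minus_closed:
  "\<lbrakk>x \<in> opspace \<O>\<^sub>t 1; x $ 0 = 0\<rbrakk> \<Longrightarrow> - x \<in> opspace \<O>\<^sub>t 1 \<and> (- x) $ 0 = 0"
  by (simp add: F.space_neg)

text \<open>Left multiplications by \<open>- x\<close> and by \<open>x\<close> commute and add up to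
  0, so the product of their exponentials is the exponential of the zero operator.\<close>

lemma fps_exp_minus:
  assumes x: "x \<in> opspace \<O>\<^sub>t 1" "x $ 0 = 0"
  shows "pcomp \<O>\<^sub>t 1 1 1 (fps_exp (- x)) (fps_exp x) = opid \<O>\<^sub>t"
proof -
  have mx: "- x \<in> opspace \<O>\<^sub>t 1" "(- x) $ 0 = 0"
    using minus_closed[OF x] by auto
  have minus: "pcomp \<O>\<^sub>t 1 1 1 (- x) y = - pcomp \<O>\<^sub>t 1 1 1 x y" if "y \<in> opspace \<O>\<^sub>t 1" for y
    using x that by (simp add: F.pcomp_minus_left)
  have "pcomp \<O>\<^sub>t 1 1 1 (fps_exp (- x)) (fps_exp x)
      = exp_op (pcomp \<O>\<^sub>t 1 1 1 (- x)) (exp_op (pcomp \<O>\<^sub>t 1 1 1 x) (opid \<O>\<^sub>t))"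
    using exp_left_mult[OF mx, of 1 "fps_exp x"] fps_exp_closed[OF x] by (simp add: fps_exp_def)
  also have "\<dots> = exp_op (\<lambda>y. pcomp \<O>\<^sub>t 1 1 1 (- x) y + pcomp \<O>\<^sub>t 1 1 1 x y) (opid \<O>\<^sub>t)"
    using x mx F.opid_closed F.pcomp_unary_left[OF x(1), of 1]
    by (intro exp_op_plus[symmetric, OF subspace filtered_left_mult filtered_left_mult])
      (simp_all add: fps_carrier_opspace minus F.pcomp_minus_right)
  also have "\<dots> = exp_op (\<lambda>y. 0) (opid \<O>\<^sub>t)"
  proof (rule exp_op_cong[of "opspace \<O> 1"])
    show "filtered 1 (opspace \<O> 1) (opspace \<O> 1) (\<lambda>y. 0)"
      by (auto simp: filtered_def linear_between_def fps_carrier_def space_0 fps_eq_iff)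
  qed (use F.opid_closed in \<open>simp_all add: fps_carrier_opspace minus\<close>)
  finally show ?thesis
    by (simp add: exp_op_zero)
qed

text \<open>The logarithm is found as a fixed point of \<open>\<Psi>\<close>, without its series.
  Coefficient \<open>k\<close> of e^x is that of \<open>x\<close> plus a contribution of the other
  powers, which involve only lower coefficients of \<open>x\<close>; hence \<open>\<Psi>\<close> is
  a contraction.\<close>

lemma fps_exp_surj:
  assumes \<phi>: "\<phi> \<in> opspace \<O>\<^sub>t 1" "\<phi> $ 0 = opid \<O>"
  shows "\<exists>x \<in> opspace \<O>\<^sub>t 1. x $ 0 = 0 \<and> fps_exp x = \<phi>"
proof -
  define S where "S = {x. \<forall>k. x $ k \<in> opspace \<O> 1 \<and> (k = 0 \<longrightarrow> x $ k = 0)}"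
  have S: "x \<in> opspace \<O>\<^sub>t 1" "x $ 0 = 0" if "x \<in> S" for x
    using that by (auto simp: S_def operad_fps_simps)
  define p where "p x n = (pcomp \<O>\<^sub>t 1 1 1 x ^^ n) (opid \<O>\<^sub>t)" for x n
  have pS: "p x (Suc n) = pcomp \<O>\<^sub>t 1 1 1 x (p x n)" for x n
    by (simp add: p_def)
  have p1: "p x 1 = x" if "x \<in> S" for x
    using S[OF that] pS[of x 0] by (simp add: p_def F.pcomp_opid_right One_nat_def[symmetric])
  have p: "p x n \<in> opspace \<O>\<^sub>t 1" if "x \<in> S" for x n
    unfolding p_def using S[OF that] F.opid_closed F.pcomp_unary_left by (induction n) auto
  have p0: "p x n $ 0 = 0" if "x \<in> S" "1 \<le> n" for x n
    using funpow_nth_eq_0[OF subspace filtered_left_mult[OF S[OF that(1)]], of 1 "opid \<O>\<^sub>t" 0 n]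
      that F.opid_closed by (simp add: p_def fps_carrier_opspace)
  \<comment> \<open>Only the first power of \<open>x\<close> sees coefficient \<open>k\<close> of
    \<open>x\<close>: in every further product the terms at \<open>a = 0\<close> and
    \<open>a = k\<close> vanish, since \<open>x\<close> and its positive powers have no constant
    term.\<close>
  have agree: "(\<forall>j<k. p x n $ j = p y n $ j) \<and> (n \<noteq> 1 \<longrightarrow> p x n $ k = p y n $ k)"
    if xy: "x \<in> S" "y \<in> S" "\<And>j. j < k \<Longrightarrow> x $ j = y $ j" for x y k n
  proof (induction n)
    case (Suc n)
    show ?case
    proof (cases "n = 0")
      case True
      then show ?thesis
        using xy p1 by (simp add: One_nat_def[symmetric])
    next
      case False
      have "pcomp \<O> 1 1 1 (x $ a) (p x n $ (j - a)) = pcomp \<O> 1 1 1 (y $ a) (p y n $ (j - a))"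
        if ja: "j \<le> k" "a \<le> j" for j a
      proof -
        consider "a = 0" | "a = k" "j = k" | "0 < a" "a < k"
          using ja by fastforce
        then show ?thesis
        proof cases
          case 1
          then show ?thesis
            using xy p opspace_fps_nth S by simp
        next
          case 2
          then show ?thesis
            using xy False p0[of _ n] opspace_fps_nth[OF S(1)] by simp
        next
          case 3
          then have "j - a < k"
            using ja by linarith
          then show ?thesis
            using Suc xy(3) 3 by simp
        qed
      qed
      then show ?thesis
        by (auto simp: pS pcomp_fps_nth intro!: sum.cong)
    qed
  qed (simp add: p_def)
  define \<Psi> where "\<Psi> x = x + (\<phi> - fps_exp x)" for x
  have "\<exists>x\<in>S. \<Psi> x = x"
  proof (rule fps_contraction_fixpoint[OF S_def])
    show "0 \<in> S"
      by (simp add: S_def space_0)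
    show "\<Psi> x \<in> S" if "x \<in> S" for x
    proof -
      have "\<Psi> x \<in> opspace \<O>\<^sub>t 1"
        unfolding \<Psi>_def using S[OF that] \<phi> fps_exp_closed F.space_add F.space_diff by simp
      moreover have "\<Psi> x $ 0 = 0"
        using S[OF that] \<phi> fps_exp_nth_0 by (simp add: \<Psi>_def)
      ultimately show ?thesis
        by (simp add: S_def operad_fps_simps)
    qed
    show "\<Psi> x $ k = \<Psi> y $ k" if xy: "x \<in> S" "y \<in> S" "\<And>j. j < k \<Longrightarrow> x $ j = y $ j" for x y k
    proof -
      \<comment> \<open>The bound is \<open>Suc k\<close>, so that the linear term
        \<open>n = 1\<close> is in range even for \<open>k = 0\<close>.\<close>
      let ?r = "\<lambda>x. \<Sum>n\<in>{0..Suc k} - {1}. opscale \<O> (1 / fact n) (p x n $ k)"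
      have "fps_exp x $ k = x $ k + ?r x" if "x \<in> S" for x
      proof -
        have "fps_exp x $ k = (\<Sum>n=0..Suc k. opscale \<O> (1 / fact n) (p x n $ k))"
          using fps_exp_nth[OF S[OF that], of k "Suc k"] by (simp add: p_def)
        also have "\<dots> = opscale \<O> (1 / fact 1) (p x 1 $ k) + ?r x"
          by (rule sum.remove) auto
        finally show ?thesis
          using p1[OF that] by simp
      qed
      moreover have "?r x = ?r y"
        using agree[OF xy] by (intro sum.cong refl) auto
      ultimately show ?thesis
        using xy by (simp add: \<Psi>_def)
    qed
  qed
  then obtain x where "x \<in> S" "\<Psi> x = x"
    by blast
  then show ?thesis
    using S[of x] by (auto simp: \<Psi>_def)
qed

section \<open>The exponential of the adjoint action in arity 2\<close>

text \<open>As \<open>x\<close> has degree 0, all signs in the bracket are trivial, and it is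
  \<open>L\<close> plus \<open>R 1\<close> plus \<open>R 2\<close>. These commute: \<open>L\<close>
  acts at the output, \<open>R 1\<close> and \<open>R 2\<close> at different inputs. The exponential
  therefore splits into three factors.\<close>

lemma exp_bracket:
  assumes x: "x \<in> opspace \<O>\<^sub>t 1" "x $ 0 = 0" and P: "P \<in> opspace \<O>\<^sub>t 2"
  shows "filtered 1 (opspace \<O> 2) (opspace \<O> 2) (operad_bracket \<O>\<^sub>t 1 2 x)" (is ?filtered)
    and "exp_op (operad_bracket \<O>\<^sub>t 1 2 x) P
      = pcomp \<O>\<^sub>t 1 2 1 (fps_exp x) (operad_gamma \<O>\<^sub>t P (fps_exp (- x)) (fps_exp (- x)))" (is ?exp)
proof -
  define L where "L = pcomp \<O>\<^sub>t 1 2 1 x"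
  define R where "R i f = pcomp \<O>\<^sub>t 2 1 i f (- x)" for i f
  have mx: "- x \<in> opspace \<O>\<^sub>t 1" "(- x) $ 0 = 0"
    using minus_closed[OF x] by auto
  have L: "filtered 1 (opspace \<O> 2) (opspace \<O> 2) L"
    unfolding L_def using filtered_left_mult[OF x] by simp
  have R: "filtered 1 (opspace \<O> 2) (opspace \<O> 2) (R i)" if "i \<in> {1, 2}" for i
    unfolding R_def using filtered_right_mult[OF mx, of i 2] that by auto
  have R12: "filtered 1 (opspace \<O> 2) (opspace \<O> 2) (\<lambda>f. R 1 f + R 2 f)"
    by (intro filtered_plus R subspace) simp_all
  have Lc: "L f \<in> opspace \<O>\<^sub>t 2" if "f \<in> opspace \<O>\<^sub>t 2" for f
    unfolding L_def using x that by (intro F.pcomp_unary_left) simp_all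
  have Rc: "R i f \<in> opspace \<O>\<^sub>t 2" if "i \<in> {1, 2}" "f \<in> opspace \<O>\<^sub>t 2" for i f
    unfolding R_def using mx that by (intro F.pcomp_unary_right) auto
  have RL: "R i (L f) = L (R i f)" if "i \<in> {1, 2}" "f \<in> opspace \<O>\<^sub>t 2" for i f
    unfolding L_def R_def using x mx that F.pcomp_unary_assoc_left[of x i 2 1 f "- x"] by auto
  have RR: "R 2 (R 1 f) = R 1 (R 2 f)" if "f \<in> opspace \<O>\<^sub>t 2" for f
    unfolding R_def using mx that by (simp add: F.pcomp_unary_unary_commute)
  have LR: "R 1 (L f) + R 2 (L f) = L (R 1 f + R 2 f)" if "f \<in> opspace \<O>\<^sub>t 2" for f
    using that RL linear_between_add[OF filtered_linear[OF L]] Rc by (simp add: fps_carrier_opspace)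
  have bracket: "operad_bracket \<O>\<^sub>t 1 2 x f = L f + (R 1 f + R 2 f)" if "f \<in> opspace \<O>\<^sub>t 2" for f
    using that x by (simp add: operad_bracket_def L_def R_def F.circ_2 F.pcomp_minus_right)
  have sum: "filtered 1 (opspace \<O> 2) (opspace \<O> 2) (\<lambda>f. L f + (R 1 f + R 2 f))"
    by (intro filtered_plus L R12 subspace) simp
  then show ?filtered
    using bracket
    by (simp add: filtered_def linear_between_def fps_carrier_opspace F.space_add F.space_scale
        flip: operad_fps_simps(1))
  have "exp_op (operad_bracket \<O>\<^sub>t 1 2 x) P = exp_op (\<lambda>f. L f + (R 1 f + R 2 f)) P"
    using bracket P by (intro exp_op_cong[OF sum]) (simp_all add: fps_carrier_opspace)
  also have "\<dots> = exp_op L (exp_op (\<lambda>f. R 1 f + R 2 f) P)"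
    using LR P by (intro exp_op_plus[OF subspace[of 2]] L R12) (simp_all add: fps_carrier_opspace)
  also have "exp_op (\<lambda>f. R 1 f + R 2 f) P = exp_op (R 1) (exp_op (R 2) P)"
    using RR P by (intro exp_op_plus[OF subspace[of 2]] R) (simp_all add: fps_carrier_opspace)
  also have "exp_op (R 2) P = pcomp \<O>\<^sub>t 2 1 2 P (fps_exp (- x))"
    unfolding R_def using P by (intro exp_right_mult mx) simp_all
  also have "exp_op (R 1) \<dots> = operad_gamma \<O>\<^sub>t P (fps_exp (- x)) (fps_exp (- x))"
    unfolding R_def operad_gamma_def using P fps_exp_closed[OF mx]
    by (intro exp_right_mult mx F.pcomp_unary_right) simp_all
  also have "exp_op L \<dots>
      = pcomp \<O>\<^sub>t 1 2 1 (fps_exp x) (operad_gamma \<O>\<^sub>t P (fps_exp (- x)) (fps_exp (- x)))"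
    unfolding L_def using P fps_exp_closed[OF mx]
    by (intro exp_left_mult x F.gamma_closed) simp_all
  finally show ?exp .
qed

text \<open>The factor e^x on the left of the exponential formula is moved across by its two-sided
  inverse e^(-x), which becomes the equivalence of deformations.\<close>

lemma exp_bracket_eq_iff:
  assumes x: "x \<in> opspace \<O>\<^sub>t 1" "x $ 0 = 0"
    and P: "P \<in> opspace \<O>\<^sub>t 2" and P': "P' \<in> opspace \<O>\<^sub>t 2"
  shows "exp_op (operad_bracket \<O>\<^sub>t 1 2 x) P = P' \<longleftrightarrow>
    pcomp \<O>\<^sub>t 1 2 1 (fps_exp (- x)) P' = operad_gamma \<O>\<^sub>t P (fps_exp (- x)) (fps_exp (- x))"
proof -
  have mx: "- x \<in> opspace \<O>\<^sub>t 1" "(- x) $ 0 = 0"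
    using minus_closed[OF x] by auto
  note e = fps_exp_closed[OF x] fps_exp_closed[OF mx]
  have 1: "pcomp \<O>\<^sub>t 1 2 1 (fps_exp (- x)) (pcomp \<O>\<^sub>t 1 2 1 (fps_exp x) Q) = Q"
    and 2: "pcomp \<O>\<^sub>t 1 2 1 (fps_exp x) (pcomp \<O>\<^sub>t 1 2 1 (fps_exp (- x)) Q) = Q"
    if "Q \<in> opspace \<O>\<^sub>t 2" for Q
    using that e fps_exp_minus[OF x] fps_exp_minus[OF mx] F.pcomp_opid_left[of 2 Q]
      F.pcomp_unary_assoc_left[of "fps_exp (- x)" 1 1 2 "fps_exp x" Q]
      F.pcomp_unary_assoc_left[of "fps_exp x" 1 1 2 "fps_exp (- x)" Q] by simp_all
  show ?thesis
    using 1[OF F.gamma_closed[OF P e(2) e(2)]] 2[OF P'] exp_bracket(2)[OF x P] by auto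
qed

section \<open>Equivalence of deformations as an equivalence relation\<close>

lemma equiv_deformation_equiv: "equiv (deformations \<O> \<pi>) (deformation_equiv \<O> \<pi>)"
proof (rule equivI)
  note defs = deformation_equiv_def
  have def2: "P \<in> opspace \<O>\<^sub>t 2" if "P \<in> deformations \<O> \<pi>" for P
    using that by (simp add: deformations_def)
  show "deformation_equiv \<O> \<pi> \<subseteq> deformations \<O> \<pi> \<times> deformations \<O> \<pi>"
    by (auto simp: defs)
  show "refl_on (deformations \<O> \<pi>) (deformation_equiv \<O> \<pi>)"
    unfolding refl_on_def defs
    using F.opid_closed F.gamma_opid F.pcomp_opid_left[of 2] def2
    by (auto intro!: bexI[of _ "opid \<O>\<^sub>t"]) (auto simp: operad_fps_simps)
  show "sym (deformation_equiv \<O> \<pi>)"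
  proof (rule symI)
    fix P P' assume "(P, P') \<in> deformation_equiv \<O> \<pi>"
    then obtain \<phi> where D: "P \<in> deformations \<O> \<pi>" "P' \<in> deformations \<O> \<pi>"
      and \<phi>: "\<phi> \<in> opspace \<O>\<^sub>t 1" "\<phi> $ 0 = opid \<O>"
      and eq: "pcomp \<O>\<^sub>t 1 2 1 \<phi> P' = operad_gamma \<O>\<^sub>t P \<phi> \<phi>"
      by (auto simp: defs)
    \<comment> \<open>Writing \<phi> as an exponential supplies a two-sided inverse with constant
      term id.\<close>
    obtain x where x: "x \<in> opspace \<O>\<^sub>t 1" "x $ 0 = 0" and \<phi>x: "fps_exp x = \<phi>"
      using fps_exp_surj[OF \<phi>] by blast
    have mx: "- x \<in> opspace \<O>\<^sub>t 1" "(- x) $ 0 = 0"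
      using minus_closed[OF x] by auto
    define \<psi> where "\<psi> = fps_exp (- x)"
    have \<psi>: "\<psi> \<in> opspace \<O>\<^sub>t 1" "\<psi> $ 0 = opid \<O>"
      using fps_exp_closed[OF mx] fps_exp_nth_0[OF mx] by (simp_all add: \<psi>_def)
    have inv: "pcomp \<O>\<^sub>t 1 1 1 \<psi> \<phi> = opid \<O>\<^sub>t" "pcomp \<O>\<^sub>t 1 1 1 \<phi> \<psi> = opid \<O>\<^sub>t"
      using fps_exp_minus[OF x] fps_exp_minus[OF mx] by (simp_all add: \<psi>_def \<phi>x)
    note P = def2[OF D(1)] and P' = def2[OF D(2)]
    have "P' = pcomp \<O>\<^sub>t 1 2 1 \<psi> (operad_gamma \<O>\<^sub>t P \<phi> \<phi>)"
      using F.pcomp_unary_assoc_left[of \<psi> 1 1 2 \<phi> P'] \<psi> \<phi> P' inv eq F.pcomp_opid_left[of 2 P']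
      by simp
    then have "operad_gamma \<O>\<^sub>t P' \<psi> \<psi>
        = pcomp \<O>\<^sub>t 1 2 1 \<psi> (operad_gamma \<O>\<^sub>t (operad_gamma \<O>\<^sub>t P \<phi> \<phi>) \<psi> \<psi>)"
      using F.pcomp_unary_gamma F.gamma_closed P \<phi> \<psi> by simp
    also have "operad_gamma \<O>\<^sub>t (operad_gamma \<O>\<^sub>t P \<phi> \<phi>) \<psi> \<psi> = P"
      using F.gamma_gamma[OF P \<phi>(1) \<psi>(1)] inv F.gamma_opid[OF P] by simp
    finally show "(P', P) \<in> deformation_equiv \<O> \<pi>"
      using D \<psi> by (auto simp: defs intro!: bexI[of _ \<psi>])
  qed
  show "trans (deformation_equiv \<O> \<pi>)"
  proof (rule transI)
    fix P P' P''
    assume "(P, P') \<in> deformation_equiv \<O> \<pi>" "(P', P'') \<in> deformation_equiv \<O> \<pi>"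
    then obtain \<phi> \<psi> where D: "P \<in> deformations \<O> \<pi>" "P' \<in> deformations \<O> \<pi>"
        "P'' \<in> deformations \<O> \<pi>"
      and \<phi>: "\<phi> \<in> opspace \<O>\<^sub>t 1" "\<phi> $ 0 = opid \<O>"
      and eq: "pcomp \<O>\<^sub>t 1 2 1 \<phi> P' = operad_gamma \<O>\<^sub>t P \<phi> \<phi>"
      and \<psi>: "\<psi> \<in> opspace \<O>\<^sub>t 1" "\<psi> $ 0 = opid \<O>"
      and eq': "pcomp \<O>\<^sub>t 1 2 1 \<psi> P'' = operad_gamma \<O>\<^sub>t P' \<psi> \<psi>"
      by (auto simp: defs)
    note P = def2[OF D(1)] and P' = def2[OF D(2)] and P'' = def2[OF D(3)]
    \<comment> \<open>The order matters: \<psi> leads from P'' to P' and \<phi> from P' to P, so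
      \<phi> is outermost.\<close>
    define \<chi> where "\<chi> = pcomp \<O>\<^sub>t 1 1 1 \<phi> \<psi>"
    have \<chi>: "\<chi> \<in> opspace \<O>\<^sub>t 1" "\<chi> $ 0 = opid \<O>"
      using \<phi> \<psi> F.pcomp_unary_left[of \<phi> 1 \<psi>] opid_closed
      by (simp_all add: \<chi>_def pcomp_fps_nth pcomp_opid_left)
    have "pcomp \<O>\<^sub>t 1 2 1 \<chi> P'' = pcomp \<O>\<^sub>t 1 2 1 \<phi> (operad_gamma \<O>\<^sub>t P' \<psi> \<psi>)"
      using F.pcomp_unary_assoc_left[of \<phi> 1 1 2 \<psi> P''] \<phi> \<psi> P'' eq' by (simp add: \<chi>_def)
    also have "\<dots> = operad_gamma \<O>\<^sub>t (operad_gamma \<O>\<^sub>t P \<phi> \<phi>) \<psi> \<psi>"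
      using F.pcomp_unary_gamma[OF P' \<psi>(1) \<psi>(1) \<phi>(1)] eq by simp
    also have "\<dots> = operad_gamma \<O>\<^sub>t P \<chi> \<chi>"
      unfolding \<chi>_def by (rule F.gamma_gamma[OF P \<phi>(1) \<psi>(1)])
    finally show "(P, P'') \<in> deformation_equiv \<O> \<pi>"
      using D \<chi> by (auto simp: defs intro!: bexI[of _ \<chi>])
  qed
qed

section \<open>Operations of the dgLa L in terms of the operad \<O>[[t]]\<close>

text \<open>The operations of L extend those of \<O> to series, whereas the preceding results
  concern the operad \<O>[[t]]. The two agree after exchanging the sum over inputs with the Cauchy
  sum.\<close>

lemma fps_bilinear_ext_circ: "fps_bilinear_ext (circ \<O> m n) F G = circ \<O>\<^sub>t m n F G"
  unfolding circ_def fps_eq_iff fps_sum_nth fps_bilinear_ext_nth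
  by (auto simp: operad_fps_simps(1) pcomp_fps_nth scale_sum_right intro: sum.swap)

lemma fps_bilinear_ext_bracket:
  "fps_bilinear_ext (operad_bracket \<O> m n) F G = operad_bracket \<O>\<^sub>t m n F G"
proof (rule fps_ext)
  fix k
  \<comment> \<open>In the second term of the bracket the arguments are exchanged, so its Cauchy sum
    runs in the opposite direction.\<close>
  have "(\<Sum>i=0..k. circ \<O> n m (G $ (k - i)) (F $ i)) = circ \<O>\<^sub>t n m G F $ k"
    using sum_antidiagonal_swap[of "\<lambda>i j. circ \<O> n m (G $ i) (F $ j)" k]
    by (simp add: fps_bilinear_ext_nth flip: fps_bilinear_ext_circ)
  then show "fps_bilinear_ext (operad_bracket \<O> m n) F G $ k = operad_bracket \<O>\<^sub>t m n F G $ k"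
    by (simp add: operad_bracket_def fps_bilinear_ext_nth sum_subtractf operad_fps_simps(1)
        flip: scale_sum_right fps_bilinear_ext_circ)
qed

lemma fps_bilinear_ext_const:
  assumes "\<And>k. b 0 (G $ k) = 0"
  shows "fps_bilinear_ext b (fps_const c) G = fps_linear_ext (b c) G"
proof (rule fps_ext)
  fix k
  have "(\<Sum>i=0..k. b (fps_const c $ i) (G $ (k - i))) = (\<Sum>i=0..k. if i = 0 then b c (G $ k) else 0)"
    using assms by (intro sum.cong) auto
  then show "fps_bilinear_ext b (fps_const c) G $ k = fps_linear_ext (b c) G $ k"
    by (simp add: fps_bilinear_ext_nth)
qed

end

section \<open>Maurer-Cartan elements and gauge orbits as deformations\<close>

locale ns_operad_multiplication = ns_operad +
  fixes \<pi>
  assumes mult: "multiplication \<O> \<pi>"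
begin

interpretation F: ns_operad "\<O>\<^sub>t"
  by (rule ns_operad_fps)

abbreviation "\<gg> \<equiv> operad_dgla \<O> \<pi>"

lemma pi_closed: "\<pi> \<in> opspace \<O> 2"
  and pi_circ: "circ \<O> 2 2 \<pi> \<pi> = 0"
  using mult by (simp_all add: multiplication_def)

lemma const_pi_closed: "fps_const \<pi> \<in> opspace \<O>\<^sub>t 2"
  by (simp add: operad_fps_simps pi_closed space_0)

lemma circ_zero:
  assumes "1 \<le> m" "1 \<le> n" "f \<in> opspace \<O> n"
  shows "circ \<O> m n 0 f = 0" "circ \<O> n m f 0 = 0"
  using assms by (simp_all add: circ_def)

lemma const_pi_circ: "circ \<O>\<^sub>t 2 2 (fps_const \<pi>) (fps_const \<pi>) = 0"
  using pi_circ pi_closed circ_zero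
  by (simp add: fps_bilinear_ext_const space_0 flip: fps_bilinear_ext_circ)
    (simp add: fps_eq_iff space_0)

lemma dgla_t_diff:
  assumes "f \<in> opspace \<O>\<^sub>t (n + 1)"
  shows "dgdiff (dgla_t \<gg>) n f = operad_bracket \<O>\<^sub>t 2 (n + 1) (fps_const \<pi>) f"
proof -
  have "dgdiff (dgla_t \<gg>) n f = fps_linear_ext (operad_bracket \<O> 2 (n + 1) \<pi>) f"
    by (simp add: dgla_t_def operad_dgla_def operad_diff_def operad_bracket_def fps_eq_iff)
  also have "\<dots> = fps_bilinear_ext (operad_bracket \<O> 2 (n + 1)) (fps_const \<pi>) f"
    using assms circ_zero[of 2 "n + 1"]
    by (intro fps_bilinear_ext_const[symmetric])
      (simp add: operad_bracket_def opspace_fps_nth)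
  finally show ?thesis
    by (simp add: fps_bilinear_ext_bracket)
qed

lemma dgla_t_simps:
  "dgspace (dgla_t \<gg>) n = {f \<in> opspace \<O>\<^sub>t (n + 1). f $ 0 = 0}"
  "dgbracket (dgla_t \<gg>) p q = operad_bracket \<O>\<^sub>t (p + 1) (q + 1)"
  "dgscale (dgla_t \<gg>) = fscale"
  by (auto simp: dgla_t_def operad_dgla_def operad_fps_simps(2) fps_bilinear_ext_bracket fun_eq_iff)

text \<open>In degree 1 half of [\<gamma>, \<gamma>] is the circle square of \<gamma>, and d
  \<gamma> consists of the two mixed terms. As \<pi> squares to 0, the Maurer-Cartan expression is
  the circle square of \<pi> + \<gamma>.\<close>

lemma maurer_cartan_iff: "\<gamma> \<in> maurer_cartan \<gg> \<longleftrightarrow> fps_const \<pi> + \<gamma> \<in> deformations \<O> \<pi>"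
proof -
  let ?p = "fps_const \<pi>"
  have eq: "dgdiff (dgla_t \<gg>) 1 \<gamma> + fscale (1 / 2) (dgbracket (dgla_t \<gg>) 1 1 \<gamma> \<gamma>)
      = circ \<O>\<^sub>t 2 2 (?p + \<gamma>) (?p + \<gamma>)" if "\<gamma> \<in> opspace \<O>\<^sub>t 2"
  proof -
    have "operad_bracket \<O>\<^sub>t 2 2 \<gamma> \<gamma> = fscale 2 (circ \<O>\<^sub>t 2 2 \<gamma> \<gamma>)"
      using scale_left_distrib[of 1 1]
      by (simp add: operad_bracket_def operad_fps_simps(1) fps_eq_iff)
    then have "fscale (1 / 2) (dgbracket (dgla_t \<gg>) 1 1 \<gamma> \<gamma>) = circ \<O>\<^sub>t 2 2 \<gamma> \<gamma>"
      by (simp add: dgla_t_simps fps_eq_iff)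
    moreover have "dgdiff (dgla_t \<gg>) 1 \<gamma> = circ \<O>\<^sub>t 2 2 ?p \<gamma> + circ \<O>\<^sub>t 2 2 \<gamma> ?p"
      using dgla_t_diff[of \<gamma> 1] that
      by (simp add: operad_bracket_def operad_fps_simps(1) fps_eq_iff)
    moreover have "circ \<O>\<^sub>t 2 2 (?p + \<gamma>) (?p + \<gamma>)
        = circ \<O>\<^sub>t 2 2 ?p ?p + (circ \<O>\<^sub>t 2 2 ?p \<gamma> + circ \<O>\<^sub>t 2 2 \<gamma> ?p) + circ \<O>\<^sub>t 2 2 \<gamma> \<gamma>"
      using that const_pi_closed
      by (simp add: F.circ_2 F.pcomp_add_left F.pcomp_add_right F.space_add)
    ultimately show ?thesis
      by (simp add: const_pi_circ)
  qed
  have "\<gamma> \<in> opspace \<O>\<^sub>t 2 \<longleftrightarrow> ?p + \<gamma> \<in> opspace \<O>\<^sub>t 2"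
    using F.space_add[OF _ const_pi_closed] F.space_diff[OF _ _ const_pi_closed, of "?p + \<gamma>"] by auto
  then show ?thesis
    using eq by (auto simp: maurer_cartan_def deformations_def dgla_t_simps(1,3) Let_def)
qed

text \<open>Since dx = [\<pi>, x] = -[x, \<pi>], the series subtracted in the action is \<pi> minus
  its image under the exponential of ad x; adding \<pi> leaves that exponential applied to \<pi> +
  \<gamma>.\<close>

lemma gauge_action_eq:
  assumes x: "x \<in> opspace \<O>\<^sub>t 1" "x $ 0 = 0" and \<gamma>: "\<gamma> \<in> opspace \<O>\<^sub>t 2"
  shows "fps_const \<pi> + gauge_action \<gg> x \<gamma>
    = exp_op (operad_bracket \<O>\<^sub>t 1 2 x) (fps_const \<pi> + \<gamma>)"
proof (rule fps_ext)
  fix k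
  define ad where "ad = operad_bracket \<O>\<^sub>t 1 2 x"
  define dx where "dx = dgdiff (dgla_t \<gg>) 0 x"
  let ?p = "fps_const \<pi>"
  note p = const_pi_closed
  have ad: "filtered 1 (opspace \<O> 2) (opspace \<O> 2) ad"
    unfolding ad_def using exp_bracket(1)[OF x p] .
  note adn = filtered_funpow[OF ad]
  note exp_nth = exp_op_nth[OF subspace ad, unfolded fps_carrier_opspace]
  have ap: "ad ?p \<in> opspace \<O>\<^sub>t 2"
    using filtered_closed[OF ad] p by (simp add: fps_carrier_opspace)
  have dx: "dx = fscale (- 1) (ad ?p)"
    using dgla_t_diff[of x 0] x
    by (simp add: dx_def ad_def operad_bracket_def operad_fps_simps(1) fps_eq_iff)
  have adx: "(ad ^^ n) dx = - (ad ^^ Suc n) ?p" for n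
    using linear_between_scale[OF filtered_linear[OF adn], of "ad ?p" n "- 1"] ap
    by (simp add: dx fps_carrier_opspace funpow_swap1 fps_eq_iff)
  define g where "g n = fscale (1 / fact (Suc n)) ((ad ^^ n) dx)" for n
  have g: "g sums Abs_fps (\<lambda>k. \<Sum>n=0..k. g n $ k)"
  proof (rule sums_fps)
    fix n k :: nat assume "k < n"
    then show "g n $ k = 0"
      using funpow_nth_eq_0[OF subspace ad, of ?p k "Suc n"] p
      by (simp add: g_def adx fps_carrier_opspace del: funpow.simps)
  qed
  have "gauge_action \<gg> x \<gamma> = exp_op ad \<gamma> - (\<Sum>n. g n)"
    by (simp add: gauge_action_def Let_def dgla_t_simps exp_op_def ad_def g_def dx_def)
  also have "(\<Sum>n. g n) = Abs_fps (\<lambda>k. \<Sum>n=0..k. g n $ k)"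
    using sums_unique[OF g] by simp
  finally have 1: "gauge_action \<gg> x \<gamma> $ k = exp_op ad \<gamma> $ k - (\<Sum>n=0..k. g n $ k)"
    by simp
  \<comment> \<open>One term more than necessary is taken, so that splitting off
    \<open>n = 0\<close> leaves the range \<open>0..k\<close> used for \<open>g\<close>.\<close>
  have "exp_op ad ?p $ k = (\<Sum>n=0..Suc k. opscale \<O> (1 / fact n) ((ad ^^ n) ?p $ k))"
    using exp_nth[OF _ p, of k "Suc k"] by simp
  also have "\<dots> = ?p $ k + (\<Sum>n=0..k. opscale \<O> (1 / fact (Suc n)) ((ad ^^ Suc n) ?p $ k))"
    by (subst sum.atLeast0_atMost_Suc_shift) simp
  also have "(\<Sum>n=0..k. opscale \<O> (1 / fact (Suc n)) ((ad ^^ Suc n) ?p $ k)) = - (\<Sum>n=0..k. g n $ k)"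
    by (simp add: g_def adx sum_negf del: funpow.simps fact_Suc)
  finally have 2: "exp_op ad ?p $ k = ?p $ k - (\<Sum>n=0..k. g n $ k)"
    by simp
  have "exp_op ad (?p + \<gamma>) $ k = exp_op ad ?p $ k + exp_op ad \<gamma> $ k"
    using linear_between_add[OF filtered_linear[OF adn]] p \<gamma> F.space_add[OF _ p \<gamma>]
    by (simp add: exp_nth[of _ k k] fps_carrier_opspace scale_right_distrib sum.distrib)
  then show "(?p + gauge_action \<gg> x \<gamma>) $ k = exp_op (operad_bracket \<O>\<^sub>t 1 2 x) (?p + \<gamma>) $ k"
    using 1 2 by (simp add: ad_def)
qed

text \<open>The gauge parameter \<open>x\<close> corresponds to the equivalence \<phi> = e^(-x).
  That the orbit consists of deformations follows by transporting associativity along \<phi>; that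
  it fills the class follows from surjectivity of the exponential.\<close>

lemma orbit_eq_class:
  assumes \<gamma>: "\<gamma> \<in> maurer_cartan \<gg>"
  shows "(+) (fps_const \<pi>) ` orbit (gauge_group \<gg>) (gauge_action \<gg>) \<gamma>
    = deformation_equiv \<O> \<pi> `` {fps_const \<pi> + \<gamma>}"
proof -
  define P where "P = fps_const \<pi> + \<gamma>"
  have PD: "P \<in> deformations \<O> \<pi>"
    using \<gamma> maurer_cartan_iff by (simp add: P_def)
  have \<gamma>2: "\<gamma> \<in> opspace \<O>\<^sub>t 2"
    using \<gamma> by (simp add: maurer_cartan_def dgla_t_simps(1) Let_def)
  have P: "P \<in> opspace \<O>\<^sub>t 2" "P $ 0 = \<pi>" "circ \<O>\<^sub>t 2 2 P P = 0"
    using PD by (simp_all add: deformations_def)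
  define X where "X = {x \<in> opspace \<O>\<^sub>t 1. x $ 0 = 0}"
  have "(+) (fps_const \<pi>) ` orbit (gauge_group \<gg>) (gauge_action \<gg>) \<gamma>
      = (\<lambda>x. exp_op (operad_bracket \<O>\<^sub>t 1 2 x) P) ` X"
    using gauge_action_eq[OF _ _ \<gamma>2]
    by (force simp: orbit_def gauge_group_def dgla_t_simps(1) X_def P_def)
  also have "\<dots> = deformation_equiv \<O> \<pi> `` {P}"
  proof (intro equalityI subsetI)
    fix P' assume "P' \<in> (\<lambda>x. exp_op (operad_bracket \<O>\<^sub>t 1 2 x) P) ` X"
    then obtain x where x: "x \<in> opspace \<O>\<^sub>t 1" "x $ 0 = 0"
      and P'x: "P' = exp_op (operad_bracket \<O>\<^sub>t 1 2 x) P"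
      by (auto simp: X_def)
    have mx: "- x \<in> opspace \<O>\<^sub>t 1" "(- x) $ 0 = 0"
      using minus_closed[OF x] by auto
    note ad = exp_bracket(1)[OF x P(1)]
    have P': "P' \<in> opspace \<O>\<^sub>t 2"
      using exp_op_closed[OF subspace ad] P by (simp add: P'x fps_carrier_opspace)
    have eq: "pcomp \<O>\<^sub>t 1 2 1 (fps_exp (- x)) P'
        = operad_gamma \<O>\<^sub>t P (fps_exp (- x)) (fps_exp (- x))"
      using exp_bracket_eq_iff[OF x P(1) P'] P'x by blast
    have "P' $ 0 = \<pi>"
      using exp_op_nth[OF subspace ad, of P 0 0] P by (simp add: P'x fps_carrier_opspace)
    \<comment> \<open>Associativity is carried from \<open>P\<close> to \<open>P'\<close> along
      e^(-x), whose left inverse is e^x.\<close>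
    moreover have "circ \<O>\<^sub>t 2 2 P' P' = 0"
      using F.circ_2_2_transfer[OF P(1) P' fps_exp_closed[OF mx] fps_exp_closed[OF x] _ eq P(3)]
        fps_exp_minus[OF mx] by simp
    ultimately have "P' \<in> deformations \<O> \<pi>"
      using P' by (simp add: deformations_def)
    then show "P' \<in> deformation_equiv \<O> \<pi> `` {P}"
      using PD eq fps_exp_closed[OF mx] fps_exp_nth_0[OF mx] by (auto simp: deformation_equiv_def)
  next
    fix P' assume "P' \<in> deformation_equiv \<O> \<pi> `` {P}"
    then obtain \<phi> where P': "P' \<in> opspace \<O>\<^sub>t 2" and \<phi>: "\<phi> \<in> opspace \<O>\<^sub>t 1" "\<phi> $ 0 = opid \<O>"
      and eq: "pcomp \<O>\<^sub>t 1 2 1 \<phi> P' = operad_gamma \<O>\<^sub>t P \<phi> \<phi>"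
      by (auto simp: deformation_equiv_def deformations_def)
    obtain y where y: "y \<in> opspace \<O>\<^sub>t 1" "y $ 0 = 0" "fps_exp y = \<phi>"
      using fps_exp_surj[OF \<phi>] by blast
    have my: "- y \<in> opspace \<O>\<^sub>t 1" "(- y) $ 0 = 0"
      using minus_closed[OF y(1,2)] by auto
    \<comment> \<open>The parameter is \<open>- y\<close> because \<phi> = e^y has to appear as the
      exponential of minus the parameter.\<close>
    have "exp_op (operad_bracket \<O>\<^sub>t 1 2 (- y)) P = P'"
      using exp_bracket_eq_iff[OF my P(1) P'] y eq by simp
    then show "P' \<in> (\<lambda>x. exp_op (operad_bracket \<O>\<^sub>t 1 2 x) P) ` X"
      using my by (auto simp: X_def)
  qed
  finally show ?thesis
    by (simp add: P_def)
qed

end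

section \<open>From single orbits to a bijection between the quotients\<close>

theorem proposition3p8:
  fixes \<O> :: "('k::field_char_0, 'a::ab_group_add) operad"
    and \<pi> :: 'a
  assumes "ns_operad \<O>"
    and "multiplication \<O> \<pi>"
  shows "equiv (deformations \<O> \<pi>) (deformation_equiv \<O> \<pi>) \<and>
    (\<exists>\<Phi>. bij_betw \<Phi> (moduli_space (operad_dgla \<O> \<pi>))
        (deformations \<O> \<pi> // deformation_equiv \<O> \<pi>) \<and>
      (\<forall>\<gamma> \<in> maurer_cartan (operad_dgla \<O> \<pi>).
         fps_const \<pi> + \<gamma> \<in> deformations \<O> \<pi> \<and>
         \<Phi> (orbit (gauge_group (operad_dgla \<O> \<pi>)) (gauge_action (operad_dgla \<O> \<pi>)) \<gamma>) =
           deformation_equiv \<O> \<pi> `` {fps_const \<pi> + \<gamma>}))"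
proof -
  interpret ns_operad_multiplication \<O> \<pi>
    using assms by (simp add: ns_operad_multiplication_def ns_operad_multiplication_axioms_def)
  \<comment> \<open>The bijection translates whole orbits as sets, so no representative is chosen,
    and its injectivity is that of translation by \<pi>.\<close>
  let ?\<Phi> = "\<lambda>S. (+) (fps_const \<pi>) ` S"
  have "P \<in> (+) (fps_const \<pi>) ` maurer_cartan \<gg>" if "P \<in> deformations \<O> \<pi>" for P
    using that maurer_cartan_iff[of "P - fps_const \<pi>"]
    by (intro image_eqI[of _ _ "P - fps_const \<pi>"]) auto
  then have MC: "(+) (fps_const \<pi>) ` maurer_cartan \<gg> = deformations \<O> \<pi>"
    by (auto simp: maurer_cartan_iff)
  have "?\<Phi> ` moduli_space \<gg>
      = (\<lambda>\<gamma>. ?\<Phi> (orbit (gauge_group \<gg>) (gauge_action \<gg>) \<gamma>)) ` maurer_cartan \<gg>"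
    unfolding moduli_space_def orbits_def by blast
  also have "\<dots> = (\<lambda>P. deformation_equiv \<O> \<pi> `` {P}) ` deformations \<O> \<pi>"
    unfolding MC[symmetric] image_image by (intro image_cong refl orbit_eq_class)
  also have "\<dots> = deformations \<O> \<pi> // deformation_equiv \<O> \<pi>"
    unfolding quotient_def by blast
  finally have "?\<Phi> ` moduli_space \<gg> = deformations \<O> \<pi> // deformation_equiv \<O> \<pi>" .
  moreover have "inj_on ?\<Phi> (moduli_space \<gg>)"
    by (intro inj_onI) (simp add: inj_image_eq_iff)
  ultimately have "bij_betw ?\<Phi> (moduli_space \<gg>) (deformations \<O> \<pi> // deformation_equiv \<O> \<pi>)"
    by (simp add: bij_betw_def)
  moreover have "fps_const \<pi> + \<gamma> \<in> deformations \<O> \<pi> \<and>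
      ?\<Phi> (orbit (gauge_group \<gg>) (gauge_action \<gg>) \<gamma>) = deformation_equiv \<O> \<pi> `` {fps_const \<pi> + \<gamma>}"
    if "\<gamma> \<in> maurer_cartan \<gg>" for \<gamma>
    using orbit_eq_class[OF that] maurer_cartan_iff that by blast
  ultimately show ?thesis
    by (intro conjI exI[of _ ?\<Phi>] ballI equiv_deformation_equiv) blast+
qed

end
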